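(* Let $\tau_0:\mathcal{D}\to\mathcal{D}$ be the permutation constructed in the context (which satisfies $|\tau_0(I)|=|I|$ for all $I\in\mathcal{D}$). For $p\in(1,2)$ and $X:=\ell_p$ one has $$\|\mathrm{Id}_X\otimes T_{\tau_0}: L^p_{X,0}\to L^p_X\|<\infty$$ but $$\|\mathrm{Id}_X\otimes T_{\tau_0}: L^q_{X,0}\to L^q_X\|=\infty\quad\text{for all } q\in(p,2].$$
   Context: $\mathcal{D}$ is the set of all dyadic intervals contained in $[0,1)$ (intervals $[j2^{-k},(j+1)2^{-k})$, $k\ge 0$, $0\le j<2^k$); $|I|$ denotes Lebesgue measure. $h_I$ is the $L_\infty$-normalized Haar function supported on $I$ ($+1$ on the left half of $I$, $-1$ on the right half, $0$ elsewhere). $L^r_X=L^r_X([0,1))$ is the Bochner space with Lebesgue measure and $L^r_{X,0}$ its subspace of mean zero functions. For an injective map $\tau:\mathcal{D}\to\mathcal{D}$ with $|\tau(I)|=|I|$ and a Banach space $X$, the rearrangement operator $\mathrm{Id}_X\otimes T_\tau$ maps $\sum_I a_I h_I$ to $\sum_I a_I h_{\tau(I)}$ for finitely supported $(a_I)_{I\in\mathcal{D}}\subseteq X$, and $$\|\mathrm{Id}_X\otimes T_\tau:L^r_{X,0}\to L^r_X\|:=\sup\Big\{\Big\|\sum_{I} a_I h_{\tau(I)}\Big\|_{L^r_X}:\Big\|\sum_I a_I h_I\Big\|_{L^r_X}\le 1\Big\}\in[0,\infty],$$ the supremum being over finitely supported families $(a_I)\subseteq X$. Construction of $\tau_0$.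 For each $n=1,2,\dots$ choose disjoint dyadic intervals $I_0^n,I_1^n,\dots,I_n^n$ of the same length, lying one directly after the other (starting with $I_0^n$), all contained in $[1-2^{-(n-1)},1-2^{-n})$ (so in $[0,1/2)$ for $n=1$, $[1/2,3/4)$ for $n=2$, $[3/4,7/8)$ for $n=3$, etc.). For fixed $n$, define $\tau_0$ on certain dyadic subintervals of these intervals by translation, as follows: - for each $k=1,\dots,n$, all dyadic subintervals of $I_k^n$ of length $2^{-k}|I_k^n|$ are shifted from $I_k^n$ to $I_0^n$ (i.e. translated by the translation taking $I_k^n$ onto $I_0^n$); - for each $j=1,\dots,n$, all dyadic subintervals of $I_{j-1}^n$ of length $2^{-k}|I_{j-1}^n|$ with $k=j,\dots,n$ are shifted from $I_{j-1}^n$ to $I_j^n$ (by the translation taking $I_{j-1}^n$ onto $I_j^n$). (Thus, at relative level $k\in\{1,\dots,n\}$, the subintervals of $I_0^n,\dots,I_k^n$ are permuted cyclically $I_0^n\to I_1^n\to\cdots\to I_k^n\to I_0^n$.) On all other dyadic intervals $\tau_0$ is the identity. *)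

theory Defs
  imports "HOL-Analysis.Analysis"
begin

definition dyadic :: "real set set" where
  "dyadic = {{real j / 2 ^ k ..< (real j + 1) / 2 ^ k} | j k :: nat. j < 2 ^ k}"

abbreviation len :: "real set \<Rightarrow> real" where
  "len I \<equiv> measure lborel I"

definition haar :: "real set \<Rightarrow> real \<Rightarrow> real" where
  "haar I x = (if x \<in> I then (if x < (Inf I + Sup I) / 2 then 1 else - 1) else 0)"


text \<open>
  A Banach space of real sequences is given by its carrier and its norm.  The exponent of
  \<open>\<ell>\<^sub>p\<close> is a real variable, so \<open>\<ell>\<^sub>p\<close> is a set of sequences and not a type.
\<close>

definition lp :: "real \<Rightarrow> (nat \<Rightarrow> real) set" where
  "lp p = {a. summable (\<lambda>m. \<bar>a m\<bar> powr p)}"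

definition lp_norm :: "real \<Rightarrow> (nat \<Rightarrow> real) \<Rightarrow> real" where
  "lp_norm p a = (\<Sum>m. \<bar>a m\<bar> powr p) powr (1 / p)"

text \<open>
  The norm of \<open>L\<^sup>r\<^sub>X([0,1))\<close>, where \<open>N\<close> is the norm of \<open>X\<close>.  It is only applied to finite sums
  of vectors times Haar functions; these are step functions, so the integral exists.
\<close>

definition bochner_norm :: "real \<Rightarrow> ((nat \<Rightarrow> real) \<Rightarrow> real) \<Rightarrow> (real \<Rightarrow> nat \<Rightarrow> real) \<Rightarrow> real" where
  "bochner_norm r N f = (LBINT x:{0..<1}. N (f x) powr r) powr (1 / r)"

definition fin_families :: "(nat \<Rightarrow> real) set \<Rightarrow> (real set \<Rightarrow> nat \<Rightarrow> real) set" where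
  "fin_families X =
     {a. (\<forall>I. a I \<in> X) \<and> {I. a I \<noteq> (\<lambda>_. 0)} \<subseteq> dyadic \<and> finite {I. a I \<noteq> (\<lambda>_. 0)}}"

text \<open>The function \<open>\<Sum>\<^sub>I a\<^sub>I h\<^bsub>\<tau>(I)\<^esub>\<close>.\<close>

definition haar_sum :: "(real set \<Rightarrow> real set) \<Rightarrow> (real set \<Rightarrow> nat \<Rightarrow> real) \<Rightarrow> real \<Rightarrow> nat \<Rightarrow> real" where
  "haar_sum \<tau> a x = (\<lambda>m. \<Sum>I | a I \<noteq> (\<lambda>_. 0). a I m * haar (\<tau> I) x)"

definition rearr_opnorm ::
  "real \<Rightarrow> (nat \<Rightarrow> real) set \<Rightarrow> ((nat \<Rightarrow> real) \<Rightarrow> real) \<Rightarrow> (real set \<Rightarrow> real set) \<Rightarrow> ennreal" where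
  "rearr_opnorm r X N \<tau> =
     (SUP a \<in> {a \<in> fin_families X. bochner_norm r N (haar_sum (\<lambda>I. I) a) \<le> 1}.
        ennreal (bochner_norm r N (haar_sum \<tau> a)))"


text \<open>
  The choice of the intervals \<open>J n k = I\<^sub>k\<^sup>n\<close>, where \<open>n \<ge> 1\<close> and \<open>k \<le> n\<close>.
  Values of \<open>J\<close> at other indices are irrelevant.
\<close>

definition block_system :: "(nat \<Rightarrow> nat \<Rightarrow> real set) \<Rightarrow> bool" where
  "block_system J \<longleftrightarrow>
     (\<forall>n\<ge>1.
        (\<forall>k\<le>n. J n k \<in> dyadic \<and> len (J n k) = len (J n 0) \<and>
                J n k \<subseteq> {1 - 1 / 2 ^ (n - 1) ..< 1 - 1 / 2 ^ n}) \<and>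
        (\<forall>k\<le>n. \<forall>l\<le>n. k \<noteq> l \<longrightarrow> J n k \<inter> J n l = {}) \<and>
        (\<forall>k<n. Inf (J n (Suc k)) = Sup (J n k)))"

definition subintervals :: "nat \<Rightarrow> real set \<Rightarrow> real set set" where
  "subintervals k L = {I \<in> dyadic. I \<subseteq> L \<and> len I = len L / 2 ^ k}"

definition shift :: "real set \<Rightarrow> real set \<Rightarrow> real set \<Rightarrow> real set" where
  "shift L L' I = (\<lambda>x. x + (Inf L' - Inf L)) ` I"

definition shifted_to :: "(nat \<Rightarrow> nat \<Rightarrow> real set) \<Rightarrow> real set \<Rightarrow> real set \<Rightarrow> bool" where
  "shifted_to J I I' \<longleftrightarrow>
     (\<exists>n\<ge>1. \<exists>k\<in>{1..n}. I \<in> subintervals k (J n k) \<and> I' = shift (J n k) (J n 0) I) \<or>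
     (\<exists>n\<ge>1. \<exists>j\<in>{1..n}. \<exists>k\<in>{j..n}.
        I \<in> subintervals k (J n (j - 1)) \<and> I' = shift (J n (j - 1)) (J n j) I)"

text \<open>
  The description operator is harmless: \<open>shifted_to_unique\<close> below shows that the image
  interval is unique.
\<close>

definition tau0 :: "(nat \<Rightarrow> nat \<Rightarrow> real set) \<Rightarrow> real set \<Rightarrow> real set" where
  "tau0 J I = (if \<exists>I'. shifted_to J I I' then (THE I'. shifted_to J I I') else I)"


lemma dyadic_nonempty: "I \<in> dyadic \<Longrightarrow> I \<noteq> {}"
  by (auto simp: dyadic_def divide_simps)

lemma dyadic_len_pos: "I \<in> dyadic \<Longrightarrow> len I > 0"
  by (auto simp: dyadic_def divide_simps)

lemma block_system_windows:
  assumes J: "block_system J" and n: "1 \<le> n" "a \<le> n" "1 \<le> m" "b \<le> m"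
    and x: "x \<in> J n a" "x \<in> J m b"
  shows "n = m"
proof -
  have *: False
    if "n < m" and "1 \<le> n" "a \<le> n" "1 \<le> m" "b \<le> m" "x \<in> J n a" "x \<in> J m b" for n m a b
  proof -
    have "x \<in> {1 - 1 / 2 ^ (n - 1) ..< 1 - 1 / 2 ^ n}"
      using J that unfolding block_system_def by blast
    moreover have "x \<in> {1 - 1 / 2 ^ (m - 1) ..< 1 - 1 / 2 ^ m}"
      using J that unfolding block_system_def by blast
    moreover have "(1::real) / 2 ^ (m - 1) \<le> 1 / 2 ^ n"
      using that by (intro divide_left_mono power_increasing) auto
    ultimately show False by auto
  qed
  show ?thesis
    using *[of n m a b] *[of m n b a] n x by (meson linorder_neqE_nat)
qed

lemma subintervals_unique:
  assumes J: "block_system J" and n: "1 \<le> n" "a \<le> n" "1 \<le> m" "b \<le> m"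
    and I: "I \<in> subintervals k (J n a)" "I \<in> subintervals l (J m b)"
  shows "n = m \<and> a = b \<and> k = l"
proof -
  obtain x where x: "x \<in> I"
    using I dyadic_nonempty unfolding subintervals_def by blast
  then have xx: "x \<in> J n a" "x \<in> J m b"
    using I unfolding subintervals_def by auto
  have nm: "n = m"
    using block_system_windows[OF J n xx] .
  have ab: "a = b"
    using J n xx unfolding nm block_system_def by blast
  have "J m b \<in> dyadic"
    using J n unfolding block_system_def by blast
  then have "len (J m b) > 0"
    by (rule dyadic_len_pos)
  moreover have "len (J m b) / 2 ^ k = len (J m b) / 2 ^ l"
    using I nm ab unfolding subintervals_def by auto
  ultimately have "k = l"
    by (auto simp: divide_simps)
  with nm ab show ?thesis by simp
qed

lemma shifted_to_unique:
  assumes J: "block_system J" and "shifted_to J I I'" "shifted_to J I I''"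
  shows "I' = I''"
proof -
  define T where "T a k = (if a = k then 0 else Suc a)" for a k :: nat
  have *: "\<exists>n a k. 1 \<le> n \<and> a \<le> n \<and> I \<in> subintervals k (J n a) \<and> K = shift (J n a) (J n (T a k)) I"
    if "shifted_to J I K" for K
    using that unfolding shifted_to_def
  proof (elim disjE exE bexE conjE)
    fix n k assume "1 \<le> n" "k \<in> {1..n}" "I \<in> subintervals k (J n k)" "K = shift (J n k) (J n 0) I"
    then show ?thesis
      by (intro exI[of _ n] exI[of _ k]) (auto simp: T_def)
  next
    fix n j k assume "1 \<le> n" "j \<in> {1..n}" "k \<in> {j..n}" "I \<in> subintervals k (J n (j - 1))"
      "K = shift (J n (j - 1)) (J n j) I"
    then show ?thesis
      by (intro exI[of _ n] exI[of _ "j - 1"] exI[of _ k]) (auto simp: T_def)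
  qed
  obtain n a k where 1: "1 \<le> n" "a \<le> n" "I \<in> subintervals k (J n a)"
      "I' = shift (J n a) (J n (T a k)) I"
    using *[OF assms(2)] by blast
  obtain m b l where 2: "1 \<le> m" "b \<le> m" "I \<in> subintervals l (J m b)"
      "I'' = shift (J m b) (J m (T b l)) I"
    using *[OF assms(3)] by blast
  show ?thesis
    using subintervals_unique[OF J 1(1,2) 2(1,2) 1(3) 2(3)] 1(4) 2(4) by simp
qed

lemma tau0_eqI: "block_system J \<Longrightarrow> shifted_to J I I' \<Longrightarrow> tau0 J I = I'"
  unfolding tau0_def using shifted_to_unique by (metis the_equality)

lemma tau0_back:
  assumes "block_system J" "k \<in> {1..n}" "I \<in> subintervals k (J n k)"
  shows "tau0 J I = shift (J n k) (J n 0) I"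
proof (rule tau0_eqI[OF assms(1)])
  have "n \<ge> 1" using assms(2) by auto
  then show "shifted_to J I (shift (J n k) (J n 0) I)"
    unfolding shifted_to_def using assms by blast
qed

lemma tau0_forward:
  assumes "block_system J" "j \<in> {1..n}" "k \<in> {j..n}" "I \<in> subintervals k (J n (j - 1))"
  shows "tau0 J I = shift (J n (j - 1)) (J n j) I"
proof (rule tau0_eqI[OF assms(1)])
  have "n \<ge> 1" using assms(2) by auto
  then show "shifted_to J I (shift (J n (j - 1)) (J n j) I)"
    unfolding shifted_to_def using assms by blast
qed

lemma tau0_other: "\<nexists>I'. shifted_to J I I' \<Longrightarrow> tau0 J I = I"
  by (simp add: tau0_def)

lemma block_system_exists: "\<exists>J. block_system J"
proof -
  define c :: "nat \<Rightarrow> nat" where "c n = 4 ^ n - 2 * 2 ^ n" for n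
  define J where "J n k = {real (c n + k) / 2 ^ (2 * n) ..< (real (c n + k) + 1) / 2 ^ (2 * n)}"
    for n k
  have p4: "(2::real) ^ (2 * n) = 2 ^ n * 2 ^ n" for n
    by (simp add: power_add mult_2)
  have cn: "real (c n) = 2 ^ n * 2 ^ n - 2 * 2 ^ n" if "n \<ge> 1" for n
  proof -
    have "2 * 2 ^ n \<le> (2::nat) ^ n * 2 ^ n"
      using power_increasing[of 1 n "2::nat"] that by simp
    then have "2 * 2 ^ n \<le> (4::nat) ^ n"
      by (simp flip: power_mult_distrib)
    then show ?thesis
      by (simp add: c_def of_nat_diff flip: power_mult_distrib)
  qed
  have n2: "real n + 1 \<le> 2 ^ n" for n :: nat
    using less_exp[of n] by (metis Suc_leI of_nat_Suc of_nat_le_iff of_nat_numeral of_nat_power add.commute)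
  have lenJ: "len (J n k) = 1 / 2 ^ (2 * n)" for n k
    unfolding J_def by (simp add: divide_simps)
  have lt: "real (c n + k) / 2 ^ (2 * n) < (real (c n + k) + 1) / 2 ^ (2 * n)" for n k
    by (simp add: divide_simps)
  have dy: "J n k \<in> dyadic" if "n \<ge> 1" "k \<le> n" for n k
  proof -
    have "real (c n + k) < 2 ^ (2 * n)"
      using cn[OF that(1)] n2[of n] that p4[of n] by auto
    then have "c n + k < 2 ^ (2 * n)"
      by (metis of_nat_less_iff of_nat_numeral of_nat_power)
    then show ?thesis unfolding dyadic_def J_def by blast
  qed
  have sub: "J n k \<subseteq> {1 - 1 / 2 ^ (n - 1) ..< 1 - 1 / 2 ^ n}" if "n \<ge> 1" "k \<le> n" for n k
  proof -
    have h: "(1::real) / 2 ^ (n - 1) = 2 / 2 ^ n"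
      using that by (cases n) auto
    have "1 - 2 / 2 ^ n = (2 ^ n * 2 ^ n - 2 * 2 ^ n) / (2 ^ n * 2 ^ n :: real)"
      by (simp add: field_simps)
    also have "\<dots> \<le> real (c n + k) / (2 ^ n * 2 ^ n)"
      using cn[OF that(1)] by (intro divide_right_mono) auto
    finally have "1 - 1 / 2 ^ (n - 1) \<le> real (c n + k) / 2 ^ (2 * n)"
      unfolding h p4 .
    moreover have "(real (c n + k) + 1) / 2 ^ (2 * n) \<le> 1 - 1 / 2 ^ n"
    proof -
      have "(real (c n + k) + 1) / (2 ^ n * 2 ^ n) \<le> (2 ^ n * 2 ^ n - 2 ^ n) / (2 ^ n * 2 ^ n)"
        using cn[OF that(1)] n2[of n] that by (intro divide_right_mono) auto
      also have "\<dots> = (1 - 1 / 2 ^ n :: real)"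
        by (simp add: field_simps)
      finally show ?thesis unfolding p4 .
    qed
    ultimately show ?thesis unfolding J_def by auto
  qed
  have disj: "J n k \<inter> J n l = {}" if "k < l" for n k l
  proof -
    have "(real (c n + k) + 1) / 2 ^ (2 * n) \<le> real (c n + l) / 2 ^ (2 * n)"
      using that by (intro divide_right_mono) auto
    then show ?thesis unfolding J_def by auto
  qed
  have "Inf (J n (Suc k)) = Sup (J n k)" for n k
    unfolding J_def using lt[of n k] lt[of n "Suc k"] by (simp add: add.commute)
  moreover have "J n k \<inter> J n l = {}" if "k \<noteq> l" for n k l
    using disj[of k l n] disj[of l k n] that by (metis Int_commute linorder_neqE_nat)
  ultimately have "block_system J"
    unfolding block_system_def using dy sub lenJ by simp
  then show ?thesis by blast
qed

end

theory Submission
  imports Defs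
begin

text \<open>
On \<open>L\<^sup>p(\<ell>\<^sub>p)\<close> the norm separates: by Fubini its \<open>p\<close>-th power is the sum over the coordinates
of the \<open>p\<close>-th powers of scalar \<open>L\<^sup>p\<close> norms. A scalar bound for the rearrangement is therefore
inherited with the same constant, and everything reduces to real coefficients.

The scalar bound comes from one computation. If \<open>s\<close> is constant, equal to \<open>v\<close>, on a dyadic
interval \<open>I\<close>, then adding \<open>c h\<^sub>I\<close> changes \<open>\<integral>|s|\<^sup>p\<close> by
\<open>|I| ((|v + c|\<^sup>p + |v - c|\<^sup>p) / 2 - |v|\<^sup>p)\<close>, a number between \<open>0\<close> (convexity) and
\<open>|I| |c|\<^sup>p\<close> (concavity of \<open>t \<mapsto> t\<^bsup>p/2\<^esup>\<close>). Every Haar sum can be built by adding Haar functions in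
order of decreasing length, so the lower bound says that stopping a Haar sum does not increase
its \<open>L\<^sup>p\<close> norm (\<open>powr_integral_stopped_le\<close>), and the upper bound says that
\<open>\<integral>|\<Sum> c\<^sub>I h\<^sub>I|\<^sup>p \<le> \<Sum> |c\<^sub>I|\<^sup>p |I|\<close> (\<open>powr_integral_haar_comb_le\<close>), which is
type \<open>p\<close>, with constant one, for martingale differences.

The intervals moved by \<open>\<tau>\<^sub>0\<close> fall into two classes. The forward ones lie in \<open>I\<^sub>i\<^sup>n\<close> at a relative
level \<open>k\<close> with \<open>i < k \<le> n\<close>; all of these are translated together to \<open>I\<^bsub>i+1\<^esub>\<^sup>n\<close>, so the
forward part of a function keeps its distribution. The diagonal ones lie in \<open>I\<^sub>k\<^sup>n\<close> at level exactly \<open>k\<close>. They are pairwise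
disjoint, so before the rearrangement \<open>\<integral>|\<Sum> c\<^sub>I h\<^sub>I|\<^sup>p\<close> equals \<open>\<Sum> |c\<^sub>I|\<^sup>p |I|\<close>; afterwards they
are stacked on top of each other over \<open>I\<^sub>0\<^sup>n\<close>, and type \<open>p\<close> bounds the result by the same number.
Both parts are differences of stopped Haar sums, hence controlled by the whole function.

For \<open>q > p\<close> the stacking is what breaks boundedness (\<open>rearr_opnorm_ge\<close>). Put on \<open>I\<^sub>k\<^sup>n\<close> the Rademacher
function of level \<open>k\<close> times the \<open>k\<close>-th unit vector of \<open>\<ell>\<^sub>p\<close>, for \<open>k = 1, \<dots>, n\<close>. Before the
rearrangement these have disjoint supports and the \<open>q\<close>-th power of the norm is \<open>n |I\<^sub>0\<^sup>n|\<close>;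
afterwards all of them live on \<open>I\<^sub>0\<^sup>n\<close>, where the \<open>\<ell>\<^sub>p\<close> norm is \<open>n\<^bsup>1/p\<^esup>\<close>, and the \<open>q\<close>-th power
is \<open>n\<^bsup>q/p\<^esup> |I\<^sub>0\<^sup>n|\<close>. The quotient of the norms is \<open>n\<^bsup>1/p - 1/q\<^esup>\<close>, which is unbounded.
\<close>

section \<open>Two-point inequalities\<close>

lemma powr_midpoint_le:
  fixes a b s :: real
  assumes "0 \<le> a" "0 \<le> b" "1 \<le> s"
  shows "((a + b) / 2) powr s \<le> (a powr s + b powr s) / 2"
proof -
  have zero: "(y / 2) powr s \<le> y powr s / 2" if "0 \<le> y" for y :: real
  proof -
    have "(1 / 2 :: real) powr s \<le> (1 / 2) powr 1"
      using assms by (intro powr_mono') auto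
    then have "y powr s * (1 / 2) powr s \<le> y powr s * (1 / 2)"
      by (intro mult_left_mono) auto
    then show ?thesis
      using that by (simp add: powr_mult[symmetric])
  qed
  show ?thesis
  proof (cases "a = 0 \<or> b = 0")
    case True
    then show ?thesis using zero[of a] zero[of b] assms by auto
  next
    case False
    then show ?thesis
      using convex_onD[OF powr_convex[OF assms(3)], of "1/2" a b] assms
      by (auto simp: field_simps)
  qed
qed

lemma powr_add_le_add_powr:
  fixes a b r :: real
  assumes "0 \<le> a" "0 \<le> b" "0 < r" "r \<le> 1"
  shows "(a + b) powr r \<le> a powr r + b powr r"
proof (cases "a + b = 0")
  case False
  have part: "x * (a + b) powr r / (a + b) \<le> x powr r" if "0 \<le> x" "x \<le> a + b" for x
  proof -
    have "x / (a + b) \<le> (x / (a + b)) powr r"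
    proof (cases "x = 0")
      case False
      then show ?thesis
        using that assms powr_mono'[of r 1 "x / (a + b)"] by (auto simp: divide_simps)
    qed auto
    then have "x / (a + b) * (a + b) powr r \<le> (x / (a + b)) powr r * (a + b) powr r"
      by (intro mult_right_mono) auto
    also have "\<dots> = x powr r"
      using that assms False by (simp add: powr_mult[symmetric])
    finally show ?thesis by simp
  qed
  have "(a + b) powr r = a * (a + b) powr r / (a + b) + b * (a + b) powr r / (a + b)"
    using False by (simp flip: add_divide_distrib distrib_right)
  then show ?thesis
    using part[of a] part[of b] assms by linarith
qed auto

lemma two_point_lower:
  fixes v c p :: real
  assumes "1 \<le> p"
  shows "\<bar>v\<bar> powr p \<le> (\<bar>v + c\<bar> powr p + \<bar>v - c\<bar> powr p) / 2"
proof -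
  have "\<bar>v\<bar> powr p \<le> ((\<bar>v + c\<bar> + \<bar>v - c\<bar>) / 2) powr p"
    using assms by (intro powr_mono2) auto
  also have "\<dots> \<le> (\<bar>v + c\<bar> powr p + \<bar>v - c\<bar> powr p) / 2"
    using assms by (intro powr_midpoint_le) auto
  finally show ?thesis .
qed

text \<open>
In terms of squares, \<open>(v + c)\<^sup>2\<close> and \<open>(v - c)\<^sup>2\<close> have mean \<open>v\<^sup>2 + c\<^sup>2\<close>. As \<open>p / 2 \<le> 1\<close>, the power
\<open>p / 2\<close> is concave, which bounds the mean of the powers by the power of the mean, and
subadditive, which separates \<open>v\<close> from \<open>c\<close>. This is where \<open>p \<le> 2\<close> enters.
\<close>

lemma two_point_upper:
  fixes v c p :: real
  assumes "0 < p" "p \<le> 2"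
  shows "(\<bar>v + c\<bar> powr p + \<bar>v - c\<bar> powr p) / 2 \<le> \<bar>v\<bar> powr p + \<bar>c\<bar> powr p"
proof -
  have sq: "(y\<^sup>2) powr (p / 2) = \<bar>y\<bar> powr p" for y :: real
    by (metis abs_ge_zero half_gt_zero_iff powr_half_sqrt powr_powr real_sqrt_abs times_divide_eq_left mult_1 zero_le_power2)
  have "((\<bar>v + c\<bar> powr p + \<bar>v - c\<bar> powr p) / 2) powr (2 / p)
      \<le> ((\<bar>v + c\<bar> powr p) powr (2 / p) + (\<bar>v - c\<bar> powr p) powr (2 / p)) / 2"
    using assms by (intro powr_midpoint_le) auto
  also have "\<dots> = v\<^sup>2 + c\<^sup>2"
    using assms by (simp add: powr_powr field_simps power2_eq_square abs_mult_self_eq)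
  finally have "(((\<bar>v + c\<bar> powr p + \<bar>v - c\<bar> powr p) / 2) powr (2 / p)) powr (p / 2)
      \<le> (v\<^sup>2 + c\<^sup>2) powr (p / 2)"
    using assms by (intro powr_mono2) auto
  then have "(\<bar>v + c\<bar> powr p + \<bar>v - c\<bar> powr p) / 2 \<le> (v\<^sup>2 + c\<^sup>2) powr (p / 2)"
    using assms by (simp add: powr_powr)
  also have "\<dots> \<le> (v\<^sup>2) powr (p / 2) + (c\<^sup>2) powr (p / 2)"
    using assms by (intro powr_add_le_add_powr) auto
  finally show ?thesis by (simp add: sq)
qed

lemma abs_add_powr_le:
  fixes x y p :: real
  assumes "0 \<le> p"
  shows "\<bar>x + y\<bar> powr p \<le> 2 powr p * (\<bar>x\<bar> powr p + \<bar>y\<bar> powr p)"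
proof -
  have "\<bar>x + y\<bar> powr p \<le> (2 * max \<bar>x\<bar> \<bar>y\<bar>) powr p"
    using assms by (intro powr_mono2) auto
  also have "\<dots> = 2 powr p * max \<bar>x\<bar> \<bar>y\<bar> powr p"
    by (simp add: powr_mult)
  also have "\<dots> \<le> 2 powr p * (\<bar>x\<bar> powr p + \<bar>y\<bar> powr p)"
    by (intro mult_left_mono) (auto simp: max_def)
  finally show ?thesis .
qed

section \<open>Dyadic intervals and Haar functions\<close>

definition cell :: "nat \<Rightarrow> nat \<Rightarrow> real set" where
  "cell m i = {real i / 2 ^ m ..< (real i + 1) / 2 ^ m}"

lemma cell_dyadic: "i < 2 ^ m \<Longrightarrow> cell m i \<in> dyadic"
  unfolding cell_def dyadic_def by blast

lemma dyadic_cell: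
  assumes "I \<in> dyadic"
  obtains m i where "i < 2 ^ m" "I = cell m i"
  using assms unfolding dyadic_def cell_def by blast

lemma len_cell: "len (cell m i) = 1 / 2 ^ m"
  unfolding cell_def by (simp add: divide_simps)

lemma Inf_cell: "Inf (cell m i) = real i / 2 ^ m"
  and Sup_cell: "Sup (cell m i) = (real i + 1) / 2 ^ m"
  unfolding cell_def by (simp_all add: divide_simps)

text \<open>
Membership in the dyadic intervals of all levels is read off from the integers \<open>\<lfloor>x 2\<^sup>m\<rfloor>\<close>, and
\<open>floor_coarsen\<close> computes the coarser of these integers from the finer ones. Nesting
and the constancy of Haar functions on short intervals both follow from this.
\<close>

lemma mem_cell_iff_floor: "x \<in> cell m i \<longleftrightarrow> \<lfloor>x * 2 ^ m\<rfloor> = int i"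
  unfolding cell_def by (auto simp: floor_eq_iff field_simps)

lemma floor_coarsen:
  fixes x :: real
  assumes "l \<le> k"
  shows "\<lfloor>x * 2 ^ l\<rfloor> = \<lfloor>x * 2 ^ k\<rfloor> div 2 ^ (k - l)"
proof -
  have "(2::real) ^ k = 2 ^ l * 2 ^ (k - l)"
    using assms by (simp flip: power_add)
  then have "x * 2 ^ l = x * 2 ^ k / real_of_int (2 ^ (k - l))"
    by simp
  then show ?thesis
    by (metis floor_divide_real_eq_div zero_le_numeral zero_le_power)
qed

lemma dyadic_subset_unit:
  assumes "I \<in> dyadic"
  shows "I \<subseteq> {0..<1}"
proof -
  obtain m i where I: "i < 2 ^ m" "I = cell m i" using assms dyadic_cell by metis
  then have "real (Suc i) \<le> real (2 ^ m)" by (subst of_nat_le_iff) auto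
  then have "(real i + 1) / 2 ^ m \<le> 1" by simp
  moreover have "0 \<le> real i / 2 ^ m" by simp
  ultimately show ?thesis unfolding I cell_def by (auto simp del: zero_le_divide_iff)
qed

lemma dyadic_nested:
  assumes "I \<in> dyadic" "K \<in> dyadic" "len I \<le> len K" "x \<in> I" "x \<in> K"
  shows "I \<subseteq> K"
proof -
  obtain k i where I: "I = cell k i" using assms dyadic_cell by metis
  obtain l j where K: "K = cell l j" using assms dyadic_cell by metis
  have "l \<le> k"
    using assms(3) unfolding I K len_cell by (simp add: divide_simps)
  then show ?thesis
    using assms(4,5) unfolding I K by (auto simp: mem_cell_iff_floor floor_coarsen[of l k])
qed

lemma dyadic_subset_eq:
  assumes "I \<in> dyadic" "K \<in> dyadic" "K \<subseteq> I" "len I \<le> len K"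
  shows "K = I"
  using assms dyadic_nested[of I K] dyadic_nonempty[of K] by blast

lemma dyadic_len_le: "I \<in> dyadic \<Longrightarrow> K \<in> dyadic \<Longrightarrow> I \<subseteq> K \<Longrightarrow> len I \<le> len K"
  using dyadic_nested[of K I] dyadic_nonempty[of I]
  by (metis dual_order.eq_iff equals0I nle_le subset_iff)

lemma haar_cell:
  "haar (cell l j) x = (if \<lfloor>x * 2 ^ l\<rfloor> = int j then if \<lfloor>x * 2 ^ Suc l\<rfloor> = 2 * int j then 1 else - 1 else 0)"
proof -
  have mid: "(Inf (cell l j) + Sup (cell l j)) / 2 = (2 * real j + 1) / 2 ^ Suc l"
    unfolding Inf_cell Sup_cell by (simp add: field_simps)
  have "(x < (2 * real j + 1) / 2 ^ Suc l) = (\<lfloor>x * 2 ^ Suc l\<rfloor> = 2 * int j)" if "\<lfloor>x * 2 ^ l\<rfloor> = int j"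
    using that by (auto simp: floor_eq_iff field_simps)
  then show ?thesis
    unfolding haar_def mid by (auto simp: mem_cell_iff_floor)
qed

lemma haar_outside: "x \<notin> I \<Longrightarrow> haar I x = 0"
  by (simp add: haar_def)

lemma haar_constant_on:
  assumes "I \<in> dyadic" "K \<in> dyadic" "\<not> K \<subseteq> I" "x \<in> I" "y \<in> I"
  shows "haar K x = haar K y"
proof (cases "I \<inter> K = {}")
  case True
  then show ?thesis using assms haar_outside by (metis disjoint_iff)
next
  case False
  obtain k i where I: "I = cell k i" using assms dyadic_cell by metis
  obtain l j where K: "K = cell l j" using assms dyadic_cell by metis
  have "len I < len K"
    using False dyadic_nested[of K I] assms by force
  then have "Suc l \<le> k"
    unfolding I K len_cell by (simp add: divide_simps)
  then have "\<lfloor>x * 2 ^ Suc l\<rfloor> = \<lfloor>y * 2 ^ Suc l\<rfloor>" "\<lfloor>x * 2 ^ l\<rfloor> = \<lfloor>y * 2 ^ l\<rfloor>"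
    using assms(4,5) unfolding I mem_cell_iff_floor
    by (auto simp: floor_coarsen[of l k] floor_coarsen[of "Suc l" k] simp del: power_Suc)
  then show ?thesis
    unfolding K haar_cell by simp
qed

section \<open>Adding a Haar function on a minimal interval\<close>

text \<open>
A class of functions that contains the finite Haar sums, is closed under linear combinations, and
consists of functions all of whose positive powers are integrable.
\<close>

definition unit_bounded :: "(real \<Rightarrow> real) \<Rightarrow> bool" where
  "unit_bounded f \<longleftrightarrow>
     f \<in> borel_measurable borel \<and> (\<exists>B. \<forall>x. \<bar>f x\<bar> \<le> B) \<and> (\<forall>x. x \<notin> {0..<1} \<longrightarrow> f x = 0)"

definition powr_integral :: "real \<Rightarrow> (real \<Rightarrow> real) \<Rightarrow> real" where
  "powr_integral p f = (LBINT x. \<bar>f x\<bar> powr p)"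

definition haar_comb :: "(real set \<Rightarrow> real) \<Rightarrow> real set set \<Rightarrow> real \<Rightarrow> real" where
  "haar_comb c S x = (\<Sum>I\<in>S. c I * haar I x)"

lemma haar_halves:
  assumes "I \<in> dyadic"
  obtains L R where "L \<in> sets lborel" "R \<in> sets lborel" "L \<inter> R = {}" "L \<union> R = I"
    "emeasure lborel L < \<infinity>" "emeasure lborel R < \<infinity>"
    "len L = len I / 2" "len R = len I / 2"
    "haar I = (\<lambda>x. indicator L x - indicator R x)"
proof -
  obtain k j where cell: "I = cell k j"
    using assms dyadic_cell by metis
  define a b where "a = real j / 2 ^ k" and "b = (real j + 1) / 2 ^ k"
  have ab: "a < b" unfolding a_def b_def by (simp add: divide_simps)
  have I: "I = {a..<b}" unfolding cell cell_def a_def b_def ..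
  have m: "(Inf I + Sup I) / 2 = (a + b) / 2" using ab unfolding I by simp
  show ?thesis
  proof (rule that[of "{a..<(a + b) / 2}" "{(a + b) / 2..<b}"])
    show "haar I = (\<lambda>x. indicator {a..<(a + b) / 2} x - indicator {(a + b) / 2..<b} x)"
      using ab by (auto simp: haar_def m fun_eq_iff I)
  qed (use ab in \<open>auto simp: I field_simps\<close>)
qed

lemma unit_bounded_haar:
  assumes "I \<in> dyadic"
  shows "unit_bounded (haar I)"
proof -
  obtain L R where LR: "L \<in> sets lborel" "R \<in> sets lborel" "haar I = (\<lambda>x. indicator L x - indicator R x)"
    using haar_halves[OF assms] by metis
  then have "haar I \<in> borel_measurable borel"
    by simp
  moreover have "\<bar>haar I x\<bar> \<le> 1" for x by (simp add: haar_def)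
  ultimately show ?thesis
    using dyadic_subset_unit[OF assms] haar_outside unfolding unit_bounded_def by blast
qed

lemma unit_bounded_zero: "unit_bounded (\<lambda>x. 0)"
  unfolding unit_bounded_def by auto

lemma unit_bounded_add:
  assumes "unit_bounded f" "unit_bounded g"
  shows "unit_bounded (\<lambda>x. f x + g x)"
proof -
  obtain A B where "\<And>x. \<bar>f x\<bar> \<le> A" "\<And>x. \<bar>g x\<bar> \<le> B"
    using assms unfolding unit_bounded_def by blast
  then have "\<bar>f x + g x\<bar> \<le> A + B" for x
    by (meson abs_triangle_ineq add_mono order_trans)
  then show ?thesis using assms unfolding unit_bounded_def by auto
qed

lemma unit_bounded_cmult:
  assumes "unit_bounded f"
  shows "unit_bounded (\<lambda>x. c * f x)"
proof -
  obtain A where "\<And>x. \<bar>f x\<bar> \<le> A"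
    using assms unfolding unit_bounded_def by blast
  then have "\<bar>c * f x\<bar> \<le> \<bar>c\<bar> * A" for x
    by (simp add: abs_mult mult_left_mono)
  then show ?thesis using assms unfolding unit_bounded_def by auto
qed

lemma unit_bounded_diff:
  "unit_bounded f \<Longrightarrow> unit_bounded g \<Longrightarrow> unit_bounded (\<lambda>x. f x - g x)"
  using unit_bounded_add[of f "\<lambda>x. - 1 * g x"] unit_bounded_cmult[of g "- 1"] by simp

lemma unit_bounded_sum:
  "(\<And>i. i \<in> A \<Longrightarrow> unit_bounded (f i)) \<Longrightarrow> unit_bounded (\<lambda>x. \<Sum>i\<in>A. f i x)"
  by (induction A rule: infinite_finite_induct) (auto intro: unit_bounded_zero unit_bounded_add)

lemma unit_bounded_haar_comb: "S \<subseteq> dyadic \<Longrightarrow> unit_bounded (haar_comb c S)"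
  unfolding haar_comb_def
  by (intro unit_bounded_sum unit_bounded_cmult unit_bounded_haar) auto

lemma integrable_powr_unit_bounded:
  assumes "unit_bounded f" "0 < p"
  shows "integrable lborel (\<lambda>x. \<bar>f x\<bar> powr p)"
proof -
  obtain B where B: "\<And>x. \<bar>f x\<bar> \<le> B"
    using assms unfolding unit_bounded_def by blast
  have "integrable lborel (\<lambda>x. B powr p * indicator {0..<1::real} x)"
    by (intro integrable_mult_right) auto
  then show ?thesis
  proof (rule Bochner_Integration.integrable_bound)
    have [measurable]: "f \<in> borel_measurable borel"
      using assms unfolding unit_bounded_def by simp
    show "(\<lambda>x. \<bar>f x\<bar> powr p) \<in> borel_measurable lborel"
      by measurable
    show "AE x in lborel. norm (\<bar>f x\<bar> powr p) \<le> norm (B powr p * indicator {0..<1::real} x)"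
      using assms B unfolding unit_bounded_def
      by (intro AE_I2) (auto intro: powr_mono2 split: split_indicator)
  qed
qed

lemma powr_integral_nonneg: "0 \<le> powr_integral p f"
  unfolding powr_integral_def by simp

lemma powr_integral_add_le:
  assumes "0 < p" "unit_bounded f" "unit_bounded g"
  shows "powr_integral p (\<lambda>x. f x + g x) \<le> 2 powr p * (powr_integral p f + powr_integral p g)"
proof -
  have "powr_integral p (\<lambda>x. f x + g x) \<le> (LBINT x. 2 powr p * (\<bar>f x\<bar> powr p + \<bar>g x\<bar> powr p))"
    unfolding powr_integral_def using assms
    by (intro integral_mono integrable_mult_right Bochner_Integration.integrable_add
        integrable_powr_unit_bounded unit_bounded_add abs_add_powr_le) auto
  also have "\<dots> = 2 powr p * (powr_integral p f + powr_integral p g)"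
    unfolding powr_integral_def using assms by (simp add: integrable_powr_unit_bounded)
  finally show ?thesis .
qed

lemma powr_integral_diff_le:
  assumes "0 < p" "unit_bounded f" "unit_bounded g"
  shows "powr_integral p (\<lambda>x. f x - g x) \<le> 2 powr p * (powr_integral p f + powr_integral p g)"
  using powr_integral_add_le[OF assms(1,2) unit_bounded_cmult[OF assms(3), of "- 1"]]
  by (simp add: powr_integral_def)

lemma powr_integral_translate: "powr_integral p (\<lambda>x. f (x - d)) = powr_integral p f"
  unfolding powr_integral_def
  using lborel_integral_real_affine[of 1 "\<lambda>x. \<bar>f x\<bar> powr p" "- d"] by (simp add: algebra_simps)

lemma powr_integral_sum_disjoint:
  assumes "0 < p" "finite Q" "\<And>i. i \<in> Q \<Longrightarrow> unit_bounded (f i)"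
    and "\<And>i j x. i \<in> Q \<Longrightarrow> j \<in> Q \<Longrightarrow> f i x \<noteq> 0 \<Longrightarrow> f j x \<noteq> 0 \<Longrightarrow> i = j"
  shows "powr_integral p (\<lambda>x. \<Sum>i\<in>Q. f i x) = (\<Sum>i\<in>Q. powr_integral p (f i))"
proof -
  have "\<bar>\<Sum>i\<in>Q. f i x\<bar> powr p = (\<Sum>i\<in>Q. \<bar>f i x\<bar> powr p)" for x
  proof (cases "\<exists>i\<in>Q. f i x \<noteq> 0")
    case True
    then obtain i where i: "i \<in> Q" "f i x \<noteq> 0" by blast
    have single: "f j x = (if j = i then f i x else 0)" if "j \<in> Q" for j
      using assms(4)[OF i(1) that i(2)] by (cases "f j x = 0") auto
    have "(\<Sum>j\<in>Q. f j x) = (\<Sum>j\<in>Q. if j = i then f i x else 0)"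
      "(\<Sum>j\<in>Q. \<bar>f j x\<bar> powr p) = (\<Sum>j\<in>Q. if j = i then \<bar>f i x\<bar> powr p else 0)"
      by (intro sum.cong refl; simp add: single)+
    then show ?thesis using i assms(2) by simp
  qed auto
  then show ?thesis
    unfolding powr_integral_def using assms(1-3) by (simp add: integrable_powr_unit_bounded)
qed

text \<open>
The function changes on \<open>I\<close> only: its value \<open>v\<close> becomes \<open>v + c\<close> on the left half and \<open>v - c\<close> on the
right half.
\<close>

lemma powr_integral_add_haar:
  assumes "0 < p" "unit_bounded f" "I \<in> dyadic" "\<And>x. x \<in> I \<Longrightarrow> f x = v"
  shows "powr_integral p (\<lambda>x. f x + c * haar I x)
    = powr_integral p f + len I * ((\<bar>v + c\<bar> powr p + \<bar>v - c\<bar> powr p) / 2 - \<bar>v\<bar> powr p)"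
proof -
  obtain L R where LR: "L \<in> sets lborel" "R \<in> sets lborel" "L \<inter> R = {}" "L \<union> R = I"
    "emeasure lborel L < \<infinity>" "emeasure lborel R < \<infinity>"
    "len L = len I / 2" "len R = len I / 2" "haar I = (\<lambda>x. indicator L x - indicator R x)"
    by (rule haar_halves[OF assms(3)])
  have eq: "\<bar>f x + c * haar I x\<bar> powr p = \<bar>f x\<bar> powr p
      + (\<bar>v + c\<bar> powr p - \<bar>v\<bar> powr p) * indicator L x + (\<bar>v - c\<bar> powr p - \<bar>v\<bar> powr p) * indicator R x" for x
  proof (cases "x \<in> I")
    case True
    then have "f x = v" using assms by simp
    then show ?thesis using True LR(3,4) unfolding LR(9) by (auto simp: indicator_def)
  next
    case False
    then show ?thesis using LR(4) unfolding LR(9) by auto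
  qed
  have "integrable lborel (indicator L :: real \<Rightarrow> real)" "integrable lborel (indicator R :: real \<Rightarrow> real)"
    using LR by auto
  then have "powr_integral p (\<lambda>x. f x + c * haar I x) = powr_integral p f
      + (\<bar>v + c\<bar> powr p - \<bar>v\<bar> powr p) * len L + (\<bar>v - c\<bar> powr p - \<bar>v\<bar> powr p) * len R"
    unfolding powr_integral_def eq using assms integrable_powr_unit_bounded[of f p] by simp
  then show ?thesis
    unfolding LR(7,8) by (simp add: field_simps)
qed

lemma powr_integral_haar:
  assumes "0 < p" "I \<in> dyadic"
  shows "powr_integral p (\<lambda>x. c * haar I x) = \<bar>c\<bar> powr p * len I"
  using powr_integral_add_haar[OF assms(1) unit_bounded_zero assms(2), of 0 c] assms(1)
  by (simp add: powr_integral_def)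

lemma haar_comb_remove:
  "finite S \<Longrightarrow> I \<in> S \<Longrightarrow> haar_comb c S = (\<lambda>x. haar_comb c (S - {I}) x + c I * haar I x)"
  unfolding haar_comb_def by (auto simp: sum.remove add.commute)

text \<open>
A Haar function is constant on \<open>I\<close> unless its interval is contained in \<open>I\<close>; so in a finite
Haar sum an interval that is minimal for inclusion sees the remaining sum as a constant.
\<close>

lemma haar_comb_constant_on:
  assumes "S \<subseteq> dyadic" "I \<in> dyadic" "\<And>K. K \<in> S \<Longrightarrow> \<not> K \<subseteq> I"
  obtains v where "\<And>x. x \<in> I \<Longrightarrow> haar_comb c S x = v"
proof -
  obtain y where y: "y \<in> I" using dyadic_nonempty[OF assms(2)] by blast
  have "haar_comb c S x = haar_comb c S y" if "x \<in> I" for x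
    unfolding haar_comb_def using assms that y
    by (intro sum.cong refl arg_cong2[where f = "(*)"] haar_constant_on[of I]) auto
  then show ?thesis using that by blast
qed

lemma exists_shortest:
  assumes "finite S" "S \<noteq> {}"
  obtains I where "I \<in> S" "\<And>K. K \<in> S \<Longrightarrow> len I \<le> len K"
  using arg_min_if_finite[OF assms, of len] by (metis not_le)

lemma powr_integral_haar_comb_remove_minimal:
  assumes "0 < p" "finite S" "S \<subseteq> dyadic" "I \<in> S"
    and minimal: "\<And>K. K \<in> S \<Longrightarrow> K \<subseteq> I \<Longrightarrow> K = I"
  obtains v where "powr_integral p (haar_comb c S) = powr_integral p (haar_comb c (S - {I}))
      + len I * ((\<bar>v + c I\<bar> powr p + \<bar>v - c I\<bar> powr p) / 2 - \<bar>v\<bar> powr p)"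
proof -
  have Id: "I \<in> dyadic" and sub: "S - {I} \<subseteq> dyadic"
    using assms by auto
  obtain v where v: "\<And>x. x \<in> I \<Longrightarrow> haar_comb c (S - {I}) x = v"
    using haar_comb_constant_on[of "S - {I}" I c] sub Id minimal by blast
  show ?thesis
    using that[of v] powr_integral_add_haar[OF assms(1) unit_bounded_haar_comb[OF sub] Id v, of "c I"]
    unfolding haar_comb_remove[OF assms(2,4), of c] by simp
qed

text \<open>
If \<open>S'\<close> contains with an interval all larger intervals of \<open>S\<close>, then the sum over \<open>S'\<close> is the sum over
\<open>S\<close> stopped at a stopping time, hence a conditional expectation of it. The intervals outside \<open>S'\<close> can be
removed one at a time: a shortest interval of \<open>S - S'\<close> is minimal in all of \<open>S\<close>, since an interval of \<open>S'\<close> inside it would force it into \<open>S'\<close>,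
and removing it can only decrease the integral, by the convexity inequality.
\<close>

lemma powr_integral_stopped_le:
  assumes "1 \<le> p" "finite S" "S \<subseteq> dyadic" "S' \<subseteq> S"
    and closed: "\<And>I K. I \<in> S' \<Longrightarrow> K \<in> S \<Longrightarrow> I \<subseteq> K \<Longrightarrow> K \<in> S'"
  shows "powr_integral p (haar_comb c S') \<le> powr_integral p (haar_comb c S)"
  using assms(2-5)
proof (induction "card (S - S')" arbitrary: S)
  case 0
  then have "S = S'" by auto
  then show ?case by simp
next
  case (Suc n)
  then have "S - S' \<noteq> {}" "finite (S - S')" by (auto simp flip: card_gt_0_iff)
  then obtain I where I: "I \<in> S - S'" "\<And>K. K \<in> S - S' \<Longrightarrow> len I \<le> len K"
    using exists_shortest by metis
  have "K = I" if "K \<in> S" "K \<subseteq> I" for K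
  proof (rule dyadic_subset_eq)
    show "len I \<le> len K"
      using that Suc.prems(4)[of K I] I by blast
  qed (use that I Suc.prems in auto)
  then obtain v where v: "powr_integral p (haar_comb c S) = powr_integral p (haar_comb c (S - {I}))
      + len I * ((\<bar>v + c I\<bar> powr p + \<bar>v - c I\<bar> powr p) / 2 - \<bar>v\<bar> powr p)"
    using powr_integral_haar_comb_remove_minimal[of p S I c] assms(1) Suc.prems(1,2) I(1) by auto
  have "powr_integral p (haar_comb c S') \<le> powr_integral p (haar_comb c (S - {I}))"
  proof (rule Suc.hyps(1))
    have "S - {I} - S' = (S - S') - {I}" by auto
    then show "n = card (S - {I} - S')" using Suc.hyps(2) I by simp
  qed (use Suc.prems I in auto)
  also have "\<dots> \<le> powr_integral p (haar_comb c S)"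
    using two_point_lower[OF assms(1), of v "c I"] unfolding v by simp
  finally show ?case .
qed

text \<open>
Removing a shortest interval \<open>I\<close> of \<open>S\<close> decreases the integral by at most \<open>|c\<^sub>I|\<^sup>p |I|\<close>.
\<close>

lemma powr_integral_haar_comb_le:
  assumes "0 < p" "p \<le> 2" "finite S" "S \<subseteq> dyadic"
  shows "powr_integral p (haar_comb c S) \<le> (\<Sum>I\<in>S. \<bar>c I\<bar> powr p * len I)"
  using assms(3,4)
proof (induction S rule: finite_psubset_induct)
  case (psubset S)
  show ?case
  proof (cases "S = {}")
    case True
    then show ?thesis by (simp add: haar_comb_def powr_integral_def)
  next
    case False
    then obtain I where I: "I \<in> S" "\<And>K. K \<in> S \<Longrightarrow> len I \<le> len K"
      using exists_shortest psubset.hyps by metis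
    have "K = I" if "K \<in> S" "K \<subseteq> I" for K
      using that I psubset.prems dyadic_subset_eq by blast
    then obtain v where v: "powr_integral p (haar_comb c S) = powr_integral p (haar_comb c (S - {I}))
        + len I * ((\<bar>v + c I\<bar> powr p + \<bar>v - c I\<bar> powr p) / 2 - \<bar>v\<bar> powr p)"
      using powr_integral_haar_comb_remove_minimal[of p S I c] assms(1) psubset.hyps psubset.prems I(1)
      by auto
    have "(\<bar>v + c I\<bar> powr p + \<bar>v - c I\<bar> powr p) / 2 - \<bar>v\<bar> powr p \<le> \<bar>c I\<bar> powr p"
      using two_point_upper[OF assms(1,2), of v "c I"] by linarith
    moreover have "powr_integral p (haar_comb c (S - {I})) \<le> (\<Sum>K\<in>S - {I}. \<bar>c K\<bar> powr p * len K)"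
      using psubset.prems I(1) by (intro psubset.IH) auto
    ultimately have "powr_integral p (haar_comb c S)
        \<le> (\<Sum>K\<in>S - {I}. \<bar>c K\<bar> powr p * len K) + len I * \<bar>c I\<bar> powr p"
      unfolding v by (intro add_mono mult_left_mono) auto
    also have "\<dots> = (\<Sum>K\<in>S. \<bar>c K\<bar> powr p * len K)"
      using psubset.hyps I by (simp add: sum.remove[of S I] mult.commute)
    finally show ?thesis .
  qed
qed

section \<open>Dyadic subintervals and translations\<close>

text \<open>
Numbers the subintervals from left to right, relative to the left end point of the block. The
numbering does not depend on the position of the block, so a translation between blocks
preserves it.
\<close>

lemma subintervals_cell:
  assumes "j < 2 ^ K"
  shows "subintervals k (cell K j) = (\<lambda>r. cell (K + k) (j * 2 ^ k + r)) ` {..<2 ^ k}"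
proof (intro equalityI subsetI)
  fix I assume "I \<in> subintervals k (cell K j)"
  then have I: "I \<in> dyadic" "I \<subseteq> cell K j" "len I = 1 / 2 ^ (K + k)"
    by (auto simp: subintervals_def len_cell power_add)
  obtain m i where mi: "i < 2 ^ m" "I = cell m i"
    using I(1) dyadic_cell by metis
  have m: "m = K + k"
    using I(3) unfolding mi len_cell by simp
  have "real i / 2 ^ m \<in> I"
    unfolding mi cell_def by (simp add: divide_simps)
  then have "real i / 2 ^ m \<in> cell K j" using I(2) by blast
  then have "real (j * 2 ^ k) \<le> real i" "real i < real ((j + 1) * 2 ^ k)"
    unfolding cell_def m by (auto simp: power_add field_simps)
  then have "j * 2 ^ k \<le> i" "i < (j + 1) * 2 ^ k"
    by (simp_all only: of_nat_le_iff of_nat_less_iff)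
  then have "i = j * 2 ^ k + (i - j * 2 ^ k)" "i - j * 2 ^ k < 2 ^ k"
    by auto
  then show "I \<in> (\<lambda>r. cell (K + k) (j * 2 ^ k + r)) ` {..<2 ^ k}"
    unfolding mi m by (intro image_eqI[of _ _ "i - j * 2 ^ k"]) auto
next
  fix I assume "I \<in> (\<lambda>r. cell (K + k) (j * 2 ^ k + r)) ` {..<2 ^ k}"
  then obtain r where r: "r < 2 ^ k" "I = cell (K + k) (j * 2 ^ k + r)" by blast
  have "j * 2 ^ k + r < (j + 1) * 2 ^ k" using r by simp
  also have "\<dots> \<le> 2 ^ K * 2 ^ k" using assms by (intro mult_right_mono) auto
  finally have "I \<in> dyadic"
    unfolding r by (intro cell_dyadic) (simp add: power_add)
  moreover have "I \<subseteq> cell K j"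
  proof -
    have "real j / 2 ^ K \<le> real (j * 2 ^ k + r) / 2 ^ (K + k)"
      by (simp add: power_add field_simps)
    moreover have "real (j * 2 ^ k + r) + 1 \<le> (real j + 1) * 2 ^ k"
    proof -
      have "real (Suc r) \<le> real (2 ^ k)" using r(1) by (subst of_nat_le_iff) auto
      then show ?thesis by (simp add: algebra_simps)
    qed
    then have "(real (j * 2 ^ k + r) + 1) / 2 ^ (K + k) \<le> (real j + 1) * 2 ^ k / 2 ^ (K + k)"
      by (intro divide_right_mono) auto
    then have "(real (j * 2 ^ k + r) + 1) / 2 ^ (K + k) \<le> (real j + 1) / 2 ^ K"
      by (simp add: power_add)
    ultimately show ?thesis unfolding r cell_def by auto
  qed
  moreover have "len I = len (cell K j) / 2 ^ k"
    unfolding r len_cell by (simp add: power_add)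
  ultimately show "I \<in> subintervals k (cell K j)"
    unfolding subintervals_def by blast
qed

lemma finite_subintervals: "L \<in> dyadic \<Longrightarrow> finite (subintervals k L)"
  by (metis dyadic_cell subintervals_cell finite_imageI finite_lessThan)

lemma shift_subinterval:
  assumes "len L = len L'" "L \<in> dyadic" "L' \<in> dyadic" "I \<in> subintervals k L"
  shows "shift L L' I \<in> subintervals k L'"
proof -
  obtain K j where L: "j < 2 ^ K" "L = cell K j" using assms dyadic_cell by metis
  obtain K' j' where L': "j' < 2 ^ K'" "L' = cell K' j'" using assms dyadic_cell by metis
  have K': "K' = K" using assms(1) unfolding L L' len_cell by simp
  obtain r where r: "r < 2 ^ k" "I = cell (K + k) (j * 2 ^ k + r)"
    using assms(4) unfolding L subintervals_cell[OF L(1)] by blast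
  have "shift L L' I = cell (K + k) (j' * 2 ^ k + r)"
    unfolding shift_def L L' K' r Inf_cell unfolding cell_def image_add_atLeastLessThan'
    by (intro arg_cong2[where f = atLeastLessThan]) (simp_all add: power_add field_simps)
  then show ?thesis
    using r(1) subintervals_cell[OF L'(1)] unfolding L' K' by blast
qed

lemma shift_shift: "shift L' L (shift L L' I) = I"
  unfolding shift_def by (simp add: image_image)

lemma haar_shift:
  assumes "I \<in> dyadic"
  shows "haar (shift L L' I) x = haar I (x - (Inf L' - Inf L))"
proof -
  define d where "d = Inf L' - Inf L"
  obtain m i where I: "I = cell m i" using assms dyadic_cell by metis
  have lt: "real i / 2 ^ m < (real i + 1) / 2 ^ m" by (simp add: divide_simps)
  have s: "shift L L' I = {real i / 2 ^ m + d ..< (real i + 1) / 2 ^ m + d}"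
    unfolding shift_def I cell_def d_def[symmetric] by simp
  have "x \<in> shift L L' I \<longleftrightarrow> x - d \<in> I"
    unfolding s by (auto simp: I cell_def)
  moreover have mid: "(Inf (shift L L' I) + Sup (shift L L' I)) / 2 = (Inf I + Sup I) / 2 + d"
    using lt unfolding s by (simp add: I cell_def field_simps)
  ultimately show ?thesis
    unfolding haar_def d_def[symmetric] mid by (simp only: diff_less_eq)
qed

lemma subinterval_dyadic: "I \<in> subintervals k L \<Longrightarrow> I \<in> dyadic"
  by (simp add: subintervals_def)

lemma ex_subinterval:
  assumes "L \<in> dyadic" "x \<in> L"
  shows "\<exists>I\<in>subintervals k L. x \<in> I"
proof -
  obtain K j where L: "j < 2 ^ K" "L = cell K j" using assms dyadic_cell by metis
  define i where "i = \<lfloor>x * 2 ^ (K + k)\<rfloor>"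
  have i: "i div 2 ^ k = int j"
    using assms(2) floor_coarsen[of K "K + k" x] unfolding L mem_cell_iff_floor i_def by simp
  define r where "r = nat (i mod 2 ^ k)"
  have r: "int r = i mod 2 ^ k" "r < 2 ^ k"
    unfolding r_def by (auto simp: nat_less_iff)
  have "i = int (j * 2 ^ k + r)"
    using div_mult_mod_eq[of i "2 ^ k"] unfolding i r(1)[symmetric] by simp
  then have "x \<in> cell (K + k) (j * 2 ^ k + r)"
    unfolding mem_cell_iff_floor i_def by simp
  then show ?thesis
    unfolding L subintervals_cell[OF L(1)] using r(2) by blast
qed

text \<open>
The Haar functions of one level over \<open>L\<close> have disjoint supports which cover \<open>L\<close>; their sum is a
Rademacher function on \<open>L\<close>.
\<close>

lemma abs_sum_haar_subintervals:
  assumes "L \<in> dyadic"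
  shows "\<bar>\<Sum>I\<in>subintervals k L. haar I x\<bar> = indicator L x"
proof (cases "x \<in> L")
  case True
  then obtain I where I: "I \<in> subintervals k L" "x \<in> I" using ex_subinterval assms by blast
  have "haar K x = 0" if "K \<in> subintervals k L - {I}" for K
  proof (rule haar_outside, rule notI)
    assume "x \<in> K"
    then have "K = I"
      using that I dyadic_nested[of K I x] dyadic_nested[of I K x] by (auto simp: subintervals_def)
    then show False using that by simp
  qed
  then have "(\<Sum>K\<in>subintervals k L. haar K x) = (\<Sum>K\<in>{I}. haar K x)"
    using I assms by (intro sum.mono_neutral_right ballI) (simp_all add: finite_subintervals)
  then show ?thesis using I True by (simp add: haar_def)
next
  case False
  then have "haar K x = 0" if "K \<in> subintervals k L" for K
    using that haar_outside unfolding subintervals_def by blast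
  then show ?thesis using False by simp
qed

section \<open>The combinatorics of the rearrangement\<close>

text \<open>
The index \<open>k\<close> is the relative level of \<open>I\<close> inside \<open>J n i\<close>. At this level the
subintervals of \<open>J n 0, \<dots>, J n k\<close> are permuted cyclically, whereas those of
\<open>J n (k + 1), \<dots>, J n n\<close> stay in place.
\<close>

definition moved :: "(nat \<Rightarrow> nat \<Rightarrow> real set) \<Rightarrow> nat \<Rightarrow> nat \<Rightarrow> nat \<Rightarrow> real set \<Rightarrow> bool" where
  "moved J n k i I \<longleftrightarrow> 1 \<le> k \<and> k \<le> n \<and> i \<le> k \<and> I \<in> subintervals k (J n i)"

definition next_block :: "nat \<Rightarrow> nat \<Rightarrow> nat" where
  "next_block k i = (if i = k then 0 else Suc i)"

lemma next_block_le: "i \<le> k \<Longrightarrow> next_block k i \<le> k"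
  by (simp add: next_block_def)

lemma next_block_inj: "i \<le> k \<Longrightarrow> i' \<le> k \<Longrightarrow> next_block k i = next_block k i' \<Longrightarrow> i = i'"
  by (auto simp: next_block_def split: if_splits)

lemma next_block_surj: "i \<le> k \<Longrightarrow> \<exists>i'\<le>k. next_block k i' = i"
  by (cases i) (auto simp: next_block_def intro: exI[of _ "i - 1"])

lemma block_dyadic: "block_system J \<Longrightarrow> 1 \<le> n \<Longrightarrow> i \<le> n \<Longrightarrow> J n i \<in> dyadic"
  unfolding block_system_def by blast

lemma block_len: "block_system J \<Longrightarrow> 1 \<le> n \<Longrightarrow> i \<le> n \<Longrightarrow> i' \<le> n \<Longrightarrow> len (J n i) = len (J n i')"
  unfolding block_system_def by metis

lemma block_unique:
  assumes "block_system J" "1 \<le> n" "i \<le> n" "1 \<le> n'" "i' \<le> n'" "x \<in> J n i" "x \<in> J n' i'"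
  shows "n = n' \<and> i = i'"
  using block_system_windows[OF assms] assms unfolding block_system_def by blast

lemma tau0_moved_eq:
  assumes "block_system J" "moved J n k i I"
  shows "tau0 J I = shift (J n i) (J n (next_block k i)) I"
proof (cases "i = k")
  case True
  then show ?thesis
    using assms tau0_back[OF assms(1), of k n I] by (auto simp: moved_def next_block_def)
next
  case False
  then show ?thesis
    using assms tau0_forward[OF assms(1), of "Suc i" n k I] by (auto simp: moved_def next_block_def)
qed

lemma tau0_not_moved:
  assumes "\<nexists>n k i. moved J n k i I"
  shows "tau0 J I = I"
proof (rule tau0_other, rule notI)
  assume "\<exists>I'. shifted_to J I I'"
  then show False
    unfolding shifted_to_def
  proof (elim exE disjE bexE conjE)
    fix n k assume "k \<in> {1..n}" "I \<in> subintervals k (J n k)"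
    then show False using assms by (auto simp: moved_def)
  next
    fix n j k assume "j \<in> {1..n}" "k \<in> {j..n}" "I \<in> subintervals k (J n (j - 1))"
    then have "moved J n k (j - 1) I" by (auto simp: moved_def)
    then show False using assms by blast
  qed
qed

lemma moved_unique:
  assumes "block_system J" "moved J n k i I" "moved J n' k' i' I"
  shows "n = n' \<and> k = k' \<and> i = i'"
  using subintervals_unique[OF assms(1), of n i n' i' I k k'] assms(2,3) by (auto simp: moved_def)

lemma moved_dyadic: "moved J n k i I \<Longrightarrow> I \<in> dyadic"
  unfolding moved_def subintervals_def by blast

text \<open>
The rearrangement keeps the window \<open>n\<close> and the level \<open>k\<close> and only advances the block index along
the cycle. Together with \<open>moved_unique\<close> this makes both injectivity and surjectivity a matter of the
cyclic permutation of the indices.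
\<close>

lemma moved_tau0:
  assumes "block_system J" "moved J n k i I"
  shows "moved J n k (next_block k i) (tau0 J I)"
  unfolding tau0_moved_eq[OF assms] using assms next_block_le[of i k]
  by (auto simp: moved_def intro!: shift_subinterval block_len block_dyadic)

lemma tau0_dyadic_len:
  assumes "block_system J" "I \<in> dyadic"
  shows "tau0 J I \<in> dyadic \<and> len (tau0 J I) = len I"
proof (cases "\<exists>n k i. moved J n k i I")
  case True
  then obtain n k i where m: "moved J n k i I" by blast
  then have "moved J n k (next_block k i) (tau0 J I)" using moved_tau0 assms by blast
  moreover have "len (J n i) = len (J n (next_block k i))"
    using m next_block_le[of i k] by (intro block_len[OF assms(1)]) (auto simp: moved_def)
  ultimately show ?thesis using m by (auto simp: moved_def subintervals_def)
next
  case False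
  then show ?thesis using assms tau0_not_moved by metis
qed

lemma tau0_inj:
  assumes "block_system J" "tau0 J I = tau0 J I'"
  shows "I = I'"
proof -
  have transfer: "\<exists>n k i. moved J n k i (tau0 J I)" if "moved J n k i I" for n k i I
    using moved_tau0[OF assms(1) that] by blast
  show ?thesis
  proof (cases "(\<exists>n k i. moved J n k i I) \<and> (\<exists>n k i. moved J n k i I')")
    case True
    then obtain n k i n' k' i' where m: "moved J n k i I" "moved J n' k' i' I'" by blast
    have "n = n' \<and> k = k' \<and> next_block k i = next_block k' i'"
      using moved_unique[OF assms(1) moved_tau0[OF assms(1) m(1)]] moved_tau0[OF assms(1) m(2)]
      unfolding assms(2) by blast
    moreover from this have "i = i'"
      using m next_block_inj[of i k i'] by (auto simp: moved_def)
    ultimately show ?thesis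
      using assms(2) shift_shift unfolding tau0_moved_eq[OF assms(1) m(1)] tau0_moved_eq[OF assms(1) m(2)]
      by metis
  next
    case False
    then show ?thesis
      using assms(2) transfer tau0_not_moved[of J I] tau0_not_moved[of J I'] by metis
  qed
qed

lemma tau0_bij:
  assumes "block_system J"
  shows "bij_betw (tau0 J) dyadic dyadic"
proof (rule bij_betwI')
  fix I assume I: "I \<in> dyadic"
  show "\<exists>K\<in>dyadic. I = tau0 J K"
  proof (cases "\<exists>n k i. moved J n k i I")
    case True
    then obtain n k i where m: "moved J n k i I" by blast
    then obtain i' where i': "i' \<le> k" "next_block k i' = i"
      using next_block_surj by (auto simp: moved_def)
    define K where "K = shift (J n i) (J n i') I"
    have K: "moved J n k i' K"
      using m i' assms unfolding K_def
      by (auto simp: moved_def intro!: shift_subinterval block_len block_dyadic)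
    have "tau0 J K = shift (J n i') (J n i) K"
      using tau0_moved_eq[OF assms K] i'(2) by simp
    also have "\<dots> = I"
      unfolding K_def by (rule shift_shift)
    finally have "tau0 J K = I" .
    then show ?thesis using K moved_dyadic by blast
  next
    case False
    then show ?thesis using I tau0_not_moved by metis
  qed
qed (use assms tau0_inj tau0_dyadic_len in blast)+

section \<open>The scalar estimate\<close>

lemma haar_comb_Diff:
  assumes "finite A" "B \<subseteq> A"
  shows "haar_comb c (A - B) = (\<lambda>x. haar_comb c A x - haar_comb c B x)"
  using assms by (auto simp: haar_comb_def fun_eq_iff sum_diff)

text \<open>
Stopping at depth \<open>g n i\<close> in the block \<open>J n i\<close>: the intervals of relative level \<open>g n i\<close> or more are
discarded. These sets are closed under passing to larger intervals, and differences of two of them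
pick out bands of levels, with a range that may vary from block to block.
\<close>

definition shallow :: "(nat \<Rightarrow> nat \<Rightarrow> real set) \<Rightarrow> (nat \<Rightarrow> nat \<Rightarrow> nat) \<Rightarrow> real set set \<Rightarrow> real set set" where
  "shallow J g S = {I \<in> S. \<forall>n\<ge>1. \<forall>i\<le>n. \<forall>k\<ge>g n i. I \<notin> subintervals k (J n i)}"

lemma subintervals_deeper:
  assumes "I \<in> dyadic" "L \<in> dyadic" "K \<in> subintervals k L" "I \<subseteq> K"
  shows "\<exists>k'\<ge>k. I \<in> subintervals k' L"
proof -
  obtain m i where I: "I = cell m i" using assms dyadic_cell by metis
  obtain K0 j where L: "L = cell K0 j" using assms dyadic_cell by metis
  have "len I \<le> len K"
    using assms by (intro dyadic_len_le) (auto simp: subintervals_def)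
  also have "\<dots> = 1 / 2 ^ (K0 + k)"
    using assms(3) unfolding L by (simp add: subintervals_def len_cell power_add)
  finally have "K0 + k \<le> m"
    unfolding I len_cell by (simp add: divide_simps)
  then have "k \<le> m - K0" "len I = len L / 2 ^ (m - K0)"
    unfolding I L len_cell by (auto simp flip: power_add)
  then show ?thesis
    using assms unfolding subintervals_def by blast
qed

lemma shallow_closed:
  assumes "block_system J" "S \<subseteq> dyadic" "I \<in> shallow J g S" "K \<in> S" "I \<subseteq> K"
  shows "K \<in> shallow J g S"
proof -
  have "K \<notin> subintervals k (J n i)" if k: "1 \<le> n" "i \<le> n" "g n i \<le> k" for n i k
  proof
    assume "K \<in> subintervals k (J n i)"
    then obtain k' where "k \<le> k'" and "I \<in> subintervals k' (J n i)"
      using subintervals_deeper[of I "J n i" K k] assms block_dyadic[OF assms(1) k(1,2)]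
      by (auto simp: shallow_def)
    moreover from this have "g n i \<le> k'" using k by simp
    ultimately show False
      using assms(3) k unfolding shallow_def by blast
  qed
  then show ?thesis using assms(4) unfolding shallow_def by blast
qed

lemma powr_integral_shallow_le:
  assumes "block_system J" "1 \<le> p" "finite S" "S \<subseteq> dyadic"
  shows "powr_integral p (haar_comb c (shallow J g S)) \<le> powr_integral p (haar_comb c S)"
proof (rule powr_integral_stopped_le[OF assms(2-4)])
  show "shallow J g S \<subseteq> S"
    unfolding shallow_def by blast
qed (rule shallow_closed[OF assms(1,4)])

lemma powr_integral_band_le:
  assumes "block_system J" "1 \<le> p" "finite S" "S \<subseteq> dyadic" "\<And>n i. i \<le> n \<Longrightarrow> g n i \<le> h n i"
  shows "powr_integral p (haar_comb c (shallow J h S - shallow J g S)) \<le> 2 powr p * (2 * powr_integral p (haar_comb c S))"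
proof -
  have "shallow J g S \<subseteq> shallow J h S"
    unfolding shallow_def using order_trans[OF assms(5)] by blast
  moreover have "shallow J h S \<subseteq> S" "shallow J g S \<subseteq> S"
    unfolding shallow_def by blast+
  ultimately have sub: "shallow J g S \<subseteq> shallow J h S" "finite (shallow J h S)" "shallow J h S \<subseteq> dyadic" "shallow J g S \<subseteq> dyadic"
    using assms(3,4) finite_subset by blast+
  have "powr_integral p (haar_comb c (shallow J h S - shallow J g S))
      \<le> 2 powr p * (powr_integral p (haar_comb c (shallow J h S)) + powr_integral p (haar_comb c (shallow J g S)))"
    unfolding haar_comb_Diff[OF sub(2,1)] using assms(2) sub
    by (intro powr_integral_diff_le unit_bounded_haar_comb) auto
  also have "\<dots> \<le> 2 powr p * (2 * powr_integral p (haar_comb c S))"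
    using powr_integral_shallow_le[OF assms(1-4), of c g] powr_integral_shallow_le[OF assms(1-4), of c h]
    by (intro mult_left_mono) auto
  finally show ?thesis .
qed

definition forward :: "(nat \<Rightarrow> nat \<Rightarrow> real set) \<Rightarrow> real set set \<Rightarrow> real set set" where
  "forward J S = {I \<in> S. \<exists>n k i. moved J n k i I \<and> i < k}"

definition diagonal :: "(nat \<Rightarrow> nat \<Rightarrow> real set) \<Rightarrow> real set set \<Rightarrow> real set set" where
  "diagonal J S = {I \<in> S. \<exists>n k. moved J n k k I}"

text \<open>
In \<open>J n i\<close> the levels above \<open>i\<close> and at most \<open>n\<close> move forward to \<open>J n (i + 1)\<close>. For \<open>i = n\<close>, where
there is no next block, this range is empty.
\<close>

lemma forward_eq_band:
  assumes "block_system J"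
  shows "forward J S = shallow J (\<lambda>n i. Suc n) S - shallow J (\<lambda>n i. Suc i) S"
proof (intro equalityI subsetI)
  fix I assume "I \<in> forward J S"
  then obtain n k i where m: "I \<in> S" "moved J n k i I" "i < k" unfolding forward_def by blast
  then have i: "1 \<le> n" "i \<le> n" "k \<le> n" "I \<in> subintervals k (J n i)" by (auto simp: moved_def)
  have "I \<in> shallow J (\<lambda>n i. Suc n) S"
    unfolding shallow_def
  proof (intro CollectI conjI allI impI notI)
    fix n' i' k' assume a: "1 \<le> n'" "i' \<le> n'" "Suc n' \<le> k'" "I \<in> subintervals k' (J n' i')"
    show False
      using subintervals_unique[OF assms i(1,2) a(1,2) i(4) a(4)] a(3) i m by simp
  qed (rule m)
  moreover have "I \<notin> shallow J (\<lambda>n i. Suc i) S"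
    unfolding shallow_def using i(1,2,4) Suc_leI[OF m(3)] by blast
  ultimately show "I \<in> shallow J (\<lambda>n i. Suc n) S - shallow J (\<lambda>n i. Suc i) S"
    by blast
next
  fix I assume I: "I \<in> shallow J (\<lambda>n i. Suc n) S - shallow J (\<lambda>n i. Suc i) S"
  then obtain n k i where i: "I \<in> S" "1 \<le> n" "i \<le> n" "Suc i \<le> k" "I \<in> subintervals k (J n i)"
    unfolding shallow_def by blast
  have "\<not> Suc n \<le> k"
    using I i unfolding shallow_def by blast
  then have "moved J n k i I" "i < k"
    using i unfolding moved_def by auto
  then show "I \<in> forward J S"
    using i(1) unfolding forward_def by blast
qed

text \<open>
The band in \<open>J n i\<close> consists of the single level \<open>i\<close>, except for \<open>i = 0\<close>: the maximum makes the
band in \<open>J n 0\<close> empty, because level \<open>0\<close> is the block itself and does not move.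
\<close>

lemma diagonal_eq_band:
  assumes "block_system J"
  shows "diagonal J S = shallow J (\<lambda>n i. Suc i) S - shallow J (\<lambda>n i. max 1 i) S"
proof (intro equalityI subsetI)
  fix I assume "I \<in> diagonal J S"
  then obtain n k where m: "I \<in> S" "moved J n k k I" unfolding diagonal_def by blast
  then have i: "1 \<le> n" "k \<le> n" "1 \<le> k" "I \<in> subintervals k (J n k)" by (auto simp: moved_def)
  have "I \<in> shallow J (\<lambda>n i. Suc i) S"
    unfolding shallow_def
  proof (intro CollectI conjI allI impI notI)
    fix n' i' k' assume a: "1 \<le> n'" "i' \<le> n'" "Suc i' \<le> k'" "I \<in> subintervals k' (J n' i')"
    show False
      using subintervals_unique[OF assms i(1,2) a(1,2) i(4) a(4)] a(3) i m by simp
  qed (rule m)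
  moreover have "max 1 k \<le> k" using i(3) by simp
  then have "I \<notin> shallow J (\<lambda>n i. max 1 i) S"
    unfolding shallow_def using i(1,2,4) by blast
  ultimately show "I \<in> shallow J (\<lambda>n i. Suc i) S - shallow J (\<lambda>n i. max 1 i) S"
    by blast
next
  fix I assume I: "I \<in> shallow J (\<lambda>n i. Suc i) S - shallow J (\<lambda>n i. max 1 i) S"
  then obtain n k i where i: "I \<in> S" "1 \<le> n" "i \<le> n" "max 1 i \<le> k" "I \<in> subintervals k (J n i)"
    unfolding shallow_def by blast
  have "\<not> Suc i \<le> k"
    using I i unfolding shallow_def by blast
  then have "k = i" using i by auto
  then have "moved J n k k I"
    using i unfolding moved_def by auto
  then show "I \<in> diagonal J S"
    using i(1) unfolding diagonal_def by blast
qed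

text \<open>
The sum \<open>\<Sum> |c\<^sub>I|\<^sup>p |I|\<close> mediates: it bounds the left side by the type \<open>p\<close> inequality, whatever the
overlaps after the rearrangement, and it equals the right side because distinct diagonal intervals are disjoint.
\<close>

lemma powr_integral_tau0_diagonal_le:
  assumes "block_system J" "0 < p" "p \<le> 2" "finite S" "S \<subseteq> dyadic"
  shows "powr_integral p (\<lambda>x. \<Sum>I\<in>diagonal J S. c I * haar (tau0 J I) x) \<le> powr_integral p (haar_comb c (diagonal J S))"
proof -
  let ?D = "diagonal J S" and ?\<tau> = "tau0 J"
  have D: "finite ?D" "?D \<subseteq> dyadic" using assms by (auto simp: diagonal_def)
  have inj: "inj_on ?\<tau> ?D" by (rule inj_onI) (rule tau0_inj[OF assms(1)])
  \<comment> \<open>The coefficients carried over to the image intervals.\<close>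
  define b where "b = c \<circ> inv_into ?D ?\<tau>"
  have b: "b (?\<tau> I) = c I" if "I \<in> ?D" for I
    using that inj by (simp add: b_def)
  have "(\<lambda>x. \<Sum>I\<in>?D. c I * haar (?\<tau> I) x) = haar_comb b (?\<tau> ` ?D)"
    unfolding haar_comb_def using inj b by (auto simp: sum.reindex)
  then have "powr_integral p (\<lambda>x. \<Sum>I\<in>?D. c I * haar (?\<tau> I) x) = powr_integral p (haar_comb b (?\<tau> ` ?D))"
    by simp
  also have "\<dots> \<le> (\<Sum>K\<in>?\<tau> ` ?D. \<bar>b K\<bar> powr p * len K)"
    using D tau0_dyadic_len[OF assms(1)] by (intro powr_integral_haar_comb_le assms) auto
  also have "\<dots> = (\<Sum>I\<in>?D. \<bar>c I\<bar> powr p * len I)"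
    using inj b D tau0_dyadic_len[OF assms(1)] by (auto simp: sum.reindex intro!: sum.cong)
  also have "\<dots> = (\<Sum>I\<in>?D. powr_integral p (\<lambda>x. c I * haar I x))"
    using D assms(2) by (intro sum.cong) (auto simp: powr_integral_haar)
  also have "\<dots> = powr_integral p (haar_comb c ?D)"
    unfolding haar_comb_def
  proof (rule powr_integral_sum_disjoint[symmetric])
    fix I K x assume I: "I \<in> ?D" and K: "K \<in> ?D"
      and nz: "c I * haar I x \<noteq> 0" "c K * haar K x \<noteq> 0"
    have x: "x \<in> I" "x \<in> K" using nz haar_outside by force+
    obtain n k where mI: "moved J n k k I" using I unfolding diagonal_def by blast
    obtain n' k' where mK: "moved J n' k' k' K" using K unfolding diagonal_def by blast
    have "n = n' \<and> k = k'"
      using x mI mK by (intro block_unique[OF assms(1), where x = x]) (auto simp: moved_def subintervals_def)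
    then have "len I = len K"
      using mI mK by (auto simp: moved_def subintervals_def)
    then show "I = K"
      using x dyadic_nested[of I K x] dyadic_nested[of K I x] mI mK moved_dyadic by auto
  qed (use D assms in \<open>auto intro: unit_bounded_cmult unit_bounded_haar\<close>)
  finally show ?thesis .
qed

text \<open>
All forward intervals of one block are shifted by the same translation. So the function is cut
into its pieces on the separate blocks, each piece is translated, and the translated pieces again
live on distinct blocks.
\<close>

lemma powr_integral_tau0_forward_eq:
  assumes "block_system J" "0 < p" "finite S"
  shows "powr_integral p (\<lambda>x. \<Sum>I\<in>forward J S. c I * haar (tau0 J I) x) = powr_integral p (haar_comb c (forward J S))"
proof -
  let ?F = "forward J S"
  have fin: "finite ?F" using assms by (auto simp: forward_def)
  have "\<forall>I\<in>?F. \<exists>q. \<exists>k. moved J (fst q) k (snd q) I \<and> snd q < k"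
    unfolding forward_def by auto
  \<comment> \<open>\<open>loc I\<close> is the pair of indices \<open>(n, i)\<close> of the block that contains \<open>I\<close>.\<close>
  then obtain loc where loc: "\<And>I. I \<in> ?F \<Longrightarrow> \<exists>k. moved J (fst (loc I)) k (snd (loc I)) I \<and> snd (loc I) < k"
    by metis
  define F where "F q = {I. I \<in> ?F \<and> loc I = q}" for q
  define u where "u q x = (\<Sum>I\<in>F q. c I * haar I x)" for q x
  define v where "v q x = (\<Sum>I\<in>F q. c I * haar (tau0 J I) x)" for q x
  have F: "\<exists>k. moved J (fst q) k (snd q) I \<and> snd q < k" if "I \<in> F q" for I q
    using that loc unfolding F_def by blast
  have Fd: "I \<in> dyadic" "tau0 J I \<in> dyadic" if "I \<in> F q" for I q
    using F[OF that] moved_dyadic tau0_dyadic_len[OF assms(1)] by blast+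
  have bounded: "unit_bounded (u q)" "unit_bounded (v q)" for q
    unfolding u_def v_def by (intro unit_bounded_sum unit_bounded_cmult unit_bounded_haar; use Fd in blast)+
  have supp_u: "1 \<le> fst q \<and> snd q \<le> fst q \<and> x \<in> J (fst q) (snd q)" if nz: "u q x \<noteq> 0" for q x
  proof -
    obtain I where I: "I \<in> F q" "c I * haar I x \<noteq> 0"
      using nz sum.neutral[of "F q" "\<lambda>I. c I * haar I x"] unfolding u_def by blast
    then have "x \<in> I" using haar_outside by force
    then show ?thesis using F[OF I(1)] by (auto simp: moved_def subintervals_def)
  qed
  have supp_v: "1 \<le> fst q \<and> Suc (snd q) \<le> fst q \<and> x \<in> J (fst q) (Suc (snd q))" if nz: "v q x \<noteq> 0" for q x
  proof -
    obtain I where I: "I \<in> F q" "c I * haar (tau0 J I) x \<noteq> 0"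
      using nz sum.neutral[of "F q" "\<lambda>I. c I * haar (tau0 J I) x"] unfolding v_def by blast
    then have x: "x \<in> tau0 J I" using haar_outside by force
    obtain k where k: "moved J (fst q) k (snd q) I" "snd q < k" using F[OF I(1)] by blast
    have "moved J (fst q) k (Suc (snd q)) (tau0 J I)"
      using moved_tau0[OF assms(1) k(1)] k(2) by (simp add: next_block_def)
    then show ?thesis using x by (auto simp: moved_def subintervals_def)
  qed
  have "v q x = u q (x - (Inf (J (fst q) (Suc (snd q))) - Inf (J (fst q) (snd q))))" for q x
    unfolding u_def v_def
  proof (intro sum.cong refl arg_cong2[where f = "(*)"])
    fix I assume I: "I \<in> F q"
    then obtain k where k: "moved J (fst q) k (snd q) I" "snd q < k" using F by blast
    show "haar (tau0 J I) x = haar I (x - (Inf (J (fst q) (Suc (snd q))) - Inf (J (fst q) (snd q))))"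
      using k Fd[OF I] by (simp add: tau0_moved_eq[OF assms(1) k(1)] next_block_def haar_shift)
  qed
  then have uv: "powr_integral p (v q) = powr_integral p (u q)" for q
    using powr_integral_translate[of p "u q"] by (metis (no_types, lifting) ext)
  have "powr_integral p (\<lambda>x. \<Sum>I\<in>?F. c I * haar (tau0 J I) x) = powr_integral p (\<lambda>x. \<Sum>q\<in>loc ` ?F. v q x)"
    unfolding v_def F_def by (subst sum.image_gen[OF fin, of _ loc]) simp
  also have "\<dots> = (\<Sum>q\<in>loc ` ?F. powr_integral p (v q))"
  proof (rule powr_integral_sum_disjoint)
    fix q q' x assume "v q x \<noteq> 0" "v q' x \<noteq> 0"
    then show "q = q'"
      using supp_v[of q x] supp_v[of q' x] block_unique[OF assms(1), of "fst q" "Suc (snd q)" "fst q'" "Suc (snd q')" x]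
      by (simp add: prod_eq_iff)
  qed (use assms fin bounded in auto)
  also have "\<dots> = (\<Sum>q\<in>loc ` ?F. powr_integral p (u q))"
    by (simp add: uv)
  also have "\<dots> = powr_integral p (\<lambda>x. \<Sum>q\<in>loc ` ?F. u q x)"
  proof (rule powr_integral_sum_disjoint[symmetric])
    fix q q' x assume "u q x \<noteq> 0" "u q' x \<noteq> 0"
    then show "q = q'"
      using supp_u[of q x] supp_u[of q' x] block_unique[OF assms(1), of "fst q" "snd q" "fst q'" "snd q'" x]
      by (simp add: prod_eq_iff)
  qed (use assms fin bounded in auto)
  also have "\<dots> = powr_integral p (haar_comb c ?F)"
    unfolding u_def F_def haar_comb_def by (simp add: sum.image_gen[OF fin, of _ loc, symmetric])
  finally show ?thesis .
qed

text \<open>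
With \<open>f\<close> the given Haar sum and \<open>f\<^sub>F\<close>, \<open>f\<^sub>D\<close> its forward and diagonal parts, the
rearranged function is \<open>(f - f\<^sub>F - f\<^sub>D) + (T f\<^sub>F + T f\<^sub>D)\<close>. Each of the last four functions costs at most
eight times the integral of \<open>f\<close>, and each binary sum or difference costs a factor \<open>2\<^sup>p \<le> 4\<close>.
\<close>

lemma powr_integral_tau0_le:
  assumes "block_system J" "1 \<le> p" "p \<le> 2" "finite S" "S \<subseteq> dyadic"
  shows "powr_integral p (\<lambda>x. \<Sum>I\<in>S. c I * haar (tau0 J I) x) \<le> 960 * powr_integral p (haar_comb c S)"
proof -
  let ?F = "forward J S" and ?D = "diagonal J S"
  let ?E = "powr_integral p (haar_comb c S)"
  define T where "T A x = (\<Sum>I\<in>A. c I * haar (tau0 J I) x)" for A x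
  have four: "2 powr p \<le> 4"
    using powr_mono[of p 2 2] assms by simp
  have sub: "finite ?F" "finite ?D" "?F \<subseteq> S" "?D \<subseteq> S" "?F \<subseteq> dyadic" "?D \<subseteq> dyadic"
    using assms by (auto simp: forward_def diagonal_def)
  have disj: "?F \<inter> ?D = {}"
    unfolding forward_def diagonal_def using moved_unique[OF assms(1)] by fastforce
  have bounded: "unit_bounded (haar_comb c A)" "unit_bounded (T A)" if "A \<subseteq> S" for A
    unfolding T_def haar_comb_def using assms(5) tau0_dyadic_len[OF assms(1)] that
    by (intro unit_bounded_sum unit_bounded_cmult unit_bounded_haar; blast)+
  have add: "powr_integral p (\<lambda>x. f x + g x) \<le> 4 * (A + B)"
    if "unit_bounded f" "unit_bounded g" "powr_integral p f \<le> A" "powr_integral p g \<le> B" for f g A B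
  proof -
    have "powr_integral p (\<lambda>x. f x + g x) \<le> 2 powr p * (powr_integral p f + powr_integral p g)"
      using assms that by (intro powr_integral_add_le) auto
    also have "\<dots> \<le> 4 * (A + B)"
      using four that powr_integral_nonneg[of p f] powr_integral_nonneg[of p g] by (intro mult_mono) auto
    finally show ?thesis .
  qed
  have diff: "powr_integral p (\<lambda>x. f x - g x) \<le> 4 * (A + B)"
    if "unit_bounded f" "unit_bounded g" "powr_integral p f \<le> A" "powr_integral p g \<le> B" for f g A B
  proof -
    have "powr_integral p (\<lambda>x. f x - g x) \<le> 2 powr p * (powr_integral p f + powr_integral p g)"
      using assms that by (intro powr_integral_diff_le) auto
    also have "\<dots> \<le> 4 * (A + B)"
      using four that powr_integral_nonneg[of p f] powr_integral_nonneg[of p g] by (intro mult_mono) auto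
    finally show ?thesis .
  qed
  have eight: "2 powr p * (2 * ?E) \<le> 8 * ?E"
    using four powr_integral_nonneg[of p "haar_comb c S"] mult_right_mono[of "2 powr p" 4 "2 * ?E"] by simp
  have F: "powr_integral p (haar_comb c ?F) \<le> 8 * ?E" and D: "powr_integral p (haar_comb c ?D) \<le> 8 * ?E"
    unfolding forward_eq_band[OF assms(1)] diagonal_eq_band[OF assms(1)]
    by (intro order_trans[OF powr_integral_band_le[OF assms(1,2,4,5)] eight]; simp)+
  have TF: "powr_integral p (T ?F) \<le> 8 * ?E"
    using F powr_integral_tau0_forward_eq[of J p S c] assms unfolding T_def by simp
  have TD: "powr_integral p (T ?D) \<le> 8 * ?E"
    using D powr_integral_tau0_diagonal_le[of J p S c] assms unfolding T_def by simp
  have "T S x = ((haar_comb c S x - haar_comb c ?F x) - haar_comb c ?D x) + (T ?F x + T ?D x)" for x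
  proof -
    let ?R = "S - ?F - ?D"
    have fixed: "tau0 J I = I" if "I \<in> ?R" for I
    proof (rule tau0_not_moved, rule notI)
      assume "\<exists>n k i. moved J n k i I"
      then obtain n k i where m: "moved J n k i I" by blast
      then have "i = k \<or> i < k" unfolding moved_def by auto
      then show False using m that unfolding forward_def diagonal_def by blast
    qed
    have split: "sum g S = sum g ?R + sum g ?F + sum g ?D" for g :: "real set \<Rightarrow> real"
    proof -
      have "sum g S = sum g ((?R \<union> ?F) \<union> ?D)"
        using sub by (intro sum.cong) auto
      also have "\<dots> = sum g (?R \<union> ?F) + sum g ?D"
        using assms sub disj by (intro sum.union_disjoint) auto
      also have "sum g (?R \<union> ?F) = sum g ?R + sum g ?F"
        using assms sub by (intro sum.union_disjoint) auto
      finally show ?thesis .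
    qed
    have "(\<Sum>I\<in>?R. c I * haar (tau0 J I) x) = (\<Sum>I\<in>?R. c I * haar I x)"
      using fixed by (intro sum.cong) auto
    then show ?thesis
      unfolding T_def haar_comb_def by (simp add: split)
  qed
  then have "powr_integral p (T S) = powr_integral p (\<lambda>x. ((haar_comb c S x - haar_comb c ?F x) - haar_comb c ?D x) + (T ?F x + T ?D x))"
    by presburger
  also have "\<dots> \<le> 4 * (4 * (4 * (?E + 8 * ?E) + 8 * ?E) + 4 * (8 * ?E + 8 * ?E))"
    using F D TF TD sub by (intro add diff unit_bounded_add unit_bounded_diff bounded) auto
  also have "\<dots> = 960 * ?E" by simp
  finally show ?thesis unfolding T_def .
qed

section \<open>Boundedness for the exponent of the sequence space\<close>

lemma lp_add:
  assumes "0 < p" "a \<in> lp p" "b \<in> lp p"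
  shows "(\<lambda>m. a m + b m) \<in> lp p"
  unfolding lp_def mem_Collect_eq
proof (rule summable_comparison_test')
  show "summable (\<lambda>m. 2 powr p * (\<bar>a m\<bar> powr p + \<bar>b m\<bar> powr p))"
    using assms unfolding lp_def by (auto intro: summable_mult summable_add)
  show "norm (\<bar>a m + b m\<bar> powr p) \<le> 2 powr p * (\<bar>a m\<bar> powr p + \<bar>b m\<bar> powr p)" for m
    using assms abs_add_powr_le[of p "a m" "b m"] by simp
qed

lemma lp_cmult:
  assumes "a \<in> lp p"
  shows "(\<lambda>m. a m * c) \<in> lp p"
  using assms unfolding lp_def by (auto simp: abs_mult powr_mult intro: summable_mult2)

lemma lp_sum:
  assumes "0 < p" "finite S" "\<And>i. i \<in> S \<Longrightarrow> a i \<in> lp p"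
  shows "(\<lambda>m. \<Sum>i\<in>S. a i m) \<in> lp p"
  using assms(2,3)
proof (induction S rule: finite_induct)
  case empty
  then show ?case by (simp add: lp_def)
next
  case (insert i S)
  then show ?case using lp_add[OF assms(1), of "a i" "\<lambda>m. \<Sum>i\<in>S. a i m"] by simp
qed

lemma lp_norm_powr:
  assumes "0 < p" "a \<in> lp p"
  shows "lp_norm p a powr p = (\<Sum>m. \<bar>a m\<bar> powr p)"
proof -
  have "0 \<le> (\<Sum>m. \<bar>a m\<bar> powr p)"
    using assms unfolding lp_def by (intro suminf_nonneg) auto
  then show ?thesis
    using assms unfolding lp_norm_def by (simp add: powr_powr)
qed

lemma summable_powr_integral_sum:
  assumes "0 < p" "finite S" "\<And>i. i \<in> S \<Longrightarrow> a i \<in> lp p" "\<And>i. i \<in> S \<Longrightarrow> K i \<in> dyadic"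
  shows "summable (\<lambda>m. powr_integral p (\<lambda>x. \<Sum>i\<in>S. a i m * haar (K i) x))"
  using assms(2-4)
proof (induction S rule: finite_induct)
  case empty
  then show ?case by (simp add: powr_integral_def)
next
  case (insert i S)
  have "summable (\<lambda>m. \<bar>a i m\<bar> powr p * len (K i))"
    using insert.prems unfolding lp_def by (intro summable_mult2) auto
  then have "summable (\<lambda>m. powr_integral p (\<lambda>x. a i m * haar (K i) x))"
    using assms(1) insert.prems by (simp add: powr_integral_haar)
  then have "summable (\<lambda>m. 2 powr p * (powr_integral p (\<lambda>x. a i m * haar (K i) x)
      + powr_integral p (\<lambda>x. \<Sum>i\<in>S. a i m * haar (K i) x)))"
    using insert by (intro summable_mult summable_add) auto
  then show ?case
  proof (rule summable_comparison_test')
    show "norm (powr_integral p (\<lambda>x. \<Sum>i\<in>insert i S. a i m * haar (K i) x))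
      \<le> 2 powr p * (powr_integral p (\<lambda>x. a i m * haar (K i) x) + powr_integral p (\<lambda>x. \<Sum>i\<in>S. a i m * haar (K i) x))" for m
      using assms(1) insert powr_integral_nonneg
      by (simp, intro powr_integral_add_le unit_bounded_sum unit_bounded_cmult unit_bounded_haar) auto
  qed
qed

text \<open>
Fubini: integration over \<open>[0,1)\<close> and summation over the coordinates are interchanged.
\<close>

lemma bochner_norm_lp_powr:
  assumes "0 < p" "a \<in> fin_families (lp p)" "\<And>I. I \<in> dyadic \<Longrightarrow> \<tau> I \<in> dyadic"
  defines "S \<equiv> {I. a I \<noteq> (\<lambda>_. 0)}"
  shows "bochner_norm p (lp_norm p) (haar_sum \<tau> a) powr p
    = (\<Sum>m. powr_integral p (\<lambda>x. \<Sum>I\<in>S. a I m * haar (\<tau> I) x))"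
proof -
  define G where "G m x = (\<Sum>I\<in>S. a I m * haar (\<tau> I) x)" for m x
  have S: "finite S" "S \<subseteq> dyadic" "\<And>I. I \<in> S \<Longrightarrow> a I \<in> lp p"
    using assms unfolding fin_families_def by auto
  have bounded: "unit_bounded (G m)" for m
    unfolding G_def using S assms(3)
    by (intro unit_bounded_sum unit_bounded_cmult unit_bounded_haar) auto
  have summable_G: "summable (\<lambda>m. powr_integral p (G m))"
    unfolding G_def using S assms(1,3) by (intro summable_powr_integral_sum) auto
  have Glp: "(\<lambda>m. G m x) \<in> lp p" for x
    unfolding G_def using S assms(1) by (intro lp_sum lp_cmult) auto
  have "set_lebesgue_integral lborel {0..<1} (\<lambda>x. lp_norm p (haar_sum \<tau> a x) powr p)
      = (LBINT x:{0..<1}. (\<Sum>m. \<bar>G m x\<bar> powr p))"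
    using lp_norm_powr[OF assms(1) Glp] by (simp add: haar_sum_def G_def S_def)
  also have "\<dots> = (LBINT x. (\<Sum>m. \<bar>G m x\<bar> powr p))"
    unfolding set_lebesgue_integral_def
  proof (intro Bochner_Integration.integral_cong refl)
    fix x :: real
    have "G m x = 0" if "x \<notin> {0..<1}" for m
      using bounded that unfolding unit_bounded_def by blast
    then show "indicator {0..<1} x *\<^sub>R (\<Sum>m. \<bar>G m x\<bar> powr p) = (\<Sum>m. \<bar>G m x\<bar> powr p)"
      by (cases "x \<in> {0..<1}") auto
  qed
  also have "\<dots> = (\<Sum>m. powr_integral p (G m))"
    unfolding powr_integral_def
  proof (rule integral_suminf)
    show "integrable lborel (\<lambda>x. \<bar>G m x\<bar> powr p)" for m
      using bounded assms(1) by (rule integrable_powr_unit_bounded)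
    show "AE x in lborel. summable (\<lambda>m. norm (\<bar>G m x\<bar> powr p))"
      using Glp unfolding lp_def by simp
    show "summable (\<lambda>m. LBINT x. norm (\<bar>G m x\<bar> powr p))"
      using summable_G unfolding powr_integral_def by simp
  qed
  finally have I: "set_lebesgue_integral lborel {0..<1} (\<lambda>x. lp_norm p (haar_sum \<tau> a x) powr p)
      = (\<Sum>m. powr_integral p (G m))" .
  have "0 \<le> (\<Sum>m. powr_integral p (G m))"
    using summable_G powr_integral_nonneg by (rule suminf_nonneg)
  then show ?thesis
    unfolding bochner_norm_def I using assms(1) by (simp add: powr_powr G_def[abs_def])
qed

lemma rearr_opnorm_finite:
  assumes "block_system J" "1 \<le> p" "p \<le> 2"
  shows "rearr_opnorm p (lp p) (lp_norm p) (tau0 J) < \<infinity>"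
proof -
  have "bochner_norm p (lp_norm p) (haar_sum (tau0 J) a) \<le> 960 powr (1 / p)"
    if a: "a \<in> fin_families (lp p)" "bochner_norm p (lp_norm p) (haar_sum (\<lambda>I. I) a) \<le> 1" for a
  proof -
    let ?B = "\<lambda>\<tau>. bochner_norm p (lp_norm p) (haar_sum \<tau> a)"
    define S where "S = {I. a I \<noteq> (\<lambda>_. 0)}"
    have S: "finite S" "S \<subseteq> dyadic" "\<And>I. I \<in> S \<Longrightarrow> a I \<in> lp p"
      using a unfolding fin_families_def S_def by auto
    have "?B (tau0 J) powr p = (\<Sum>m. powr_integral p (\<lambda>x. \<Sum>I\<in>S. a I m * haar (tau0 J I) x))"
      unfolding S_def using assms a tau0_dyadic_len[OF assms(1)] by (intro bochner_norm_lp_powr) auto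
    also have "\<dots> \<le> (\<Sum>m. 960 * powr_integral p (\<lambda>x. \<Sum>I\<in>S. a I m * haar I x))"
      using S assms tau0_dyadic_len[OF assms(1)] powr_integral_tau0_le[OF assms S(1,2)]
      by (intro suminf_le summable_mult summable_powr_integral_sum) (auto simp: haar_comb_def[abs_def])
    also have "\<dots> = 960 * (\<Sum>m. powr_integral p (\<lambda>x. \<Sum>I\<in>S. a I m * haar I x))"
      using S assms by (intro suminf_mult summable_powr_integral_sum) auto
    also have "\<dots> = 960 * ?B (\<lambda>I. I) powr p"
      unfolding S_def using assms a bochner_norm_lp_powr[of p a "\<lambda>I. I"] by simp
    also have "\<dots> \<le> 960 * 1 powr p"
      using assms a(2) by (intro mult_left_mono powr_mono2) (auto simp: bochner_norm_def)
    finally have "(?B (tau0 J) powr p) powr (1 / p) \<le> 960 powr (1 / p)"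
      using assms by (intro powr_mono2) auto
    moreover have "0 \<le> ?B (tau0 J)"
      by (simp add: bochner_norm_def)
    ultimately show ?thesis
      using assms by (simp add: powr_powr)
  qed
  then have "rearr_opnorm p (lp p) (lp_norm p) (tau0 J) \<le> ennreal (960 powr (1 / p))"
    unfolding rearr_opnorm_def by (intro SUP_least ennreal_leI) auto
  then show ?thesis
    using ennreal_less_top le_less_trans by (metis infinity_ennreal_def)
qed

section \<open>Unboundedness for larger exponents\<close>

lemma lp_norm_finite_support:
  assumes "0 < p" "finite M" "\<And>m. \<bar>v m\<bar> = (if m \<in> M then w m else 0)"
  shows "lp_norm p v = (\<Sum>m\<in>M. w m powr p) powr (1 / p)"
proof -
  have "(\<Sum>m. \<bar>v m\<bar> powr p) = (\<Sum>m\<in>M. \<bar>v m\<bar> powr p)"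
    using assms by (intro suminf_finite) auto
  also have "\<dots> = (\<Sum>m\<in>M. w m powr p)"
    using assms(3) by (intro sum.cong) auto
  finally show ?thesis unfolding lp_norm_def by simp
qed

lemma emeasure_unit_subset: "A \<subseteq> {0..<1::real} \<Longrightarrow> emeasure lborel A < \<infinity>"
  by (rule le_less_trans[OF emeasure_mono[of A "{0..<1}"]]) auto

lemma bochner_norm_indicator:
  assumes "0 < q" "0 \<le> K" "A \<subseteq> {0..<1}" "A \<in> sets lborel"
    and N: "\<And>x. N (f x) = K * indicator A x"
  shows "bochner_norm q N f = K * len A powr (1 / q)"
proof -
  have "(LBINT x:{0..<1}. N (f x) powr q) = (LBINT x. K powr q * indicator A x)"
    unfolding set_lebesgue_integral_def N using assms(1,3)
    by (intro Bochner_Integration.integral_cong) (auto simp: indicator_def)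
  also have "\<dots> = K powr q * len A"
    using assms(4) emeasure_unit_subset[OF assms(3)] by simp
  finally have I: "(LBINT x:{0..<1}. N (f x) powr q) = K powr q * len A" .
  show ?thesis
    unfolding bochner_norm_def I using assms(1,2) by (simp add: powr_mult powr_powr)
qed

text \<open>
On the subintervals of level \<open>m\<close> of \<open>J n m\<close> the coefficient is \<open>c\<close> times the \<open>m\<close>-th unit vector, for
\<open>1 \<le> m \<le> n\<close>. Before the rearrangement the \<open>\<ell>\<^sub>p\<close> norm of the Haar sum is \<open>c\<close> on the union of \<open>n\<close>
disjoint blocks; afterwards it is \<open>c n\<^bsup>1/p\<^esup>\<close> on the single block \<open>J n 0\<close>.
\<close>

lemma rearr_opnorm_ge:
  assumes "block_system J" "0 < p" "0 < q" "1 \<le> n"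
  shows "ennreal (real n powr (1 / p - 1 / q)) \<le> rearr_opnorm q (lp p) (lp_norm p) (tau0 J)"
proof -
  define l where "l = len (J n 0)"
  have Jd: "J n m \<in> dyadic" and Jl: "len (J n m) = l" if "m \<le> n" for m
    using block_dyadic[OF assms(1,4)] block_len[OF assms(1,4), of m 0] that unfolding l_def by auto
  have l: "0 < l" using dyadic_len_pos[OF Jd[of 0]] Jl[of 0] by simp
  \<comment> \<open>The normalization that gives the original Haar sum norm one.\<close>
  define c where "c = (real n * l) powr (- 1 / q)"
  have c: "0 < c" using assms l unfolding c_def by simp
  define a where "a I m = (if m \<in> {1..n} \<and> I \<in> subintervals m (J n m) then c else 0)" for I m
  define S where "S = {I. a I \<noteq> (\<lambda>_. 0)}"
  have S: "S = (\<Union>m\<in>{1..n}. subintervals m (J n m))"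
    unfolding S_def a_def fun_eq_iff using c by auto
  have fin: "finite S" and Sd: "S \<subseteq> dyadic"
    unfolding S using Jd finite_subintervals subinterval_dyadic by auto
  have "a I \<in> lp p" for I
    unfolding lp_def mem_Collect_eq
    by (rule summable_finite[of "{1..n}"]) (use assms in \<open>auto simp: a_def\<close>)
  then have a: "a \<in> fin_families (lp p)"
    unfolding fin_families_def using fin Sd unfolding S_def by blast
  have comp: "haar_sum \<tau> a x m = (if m \<in> {1..n} then c * (\<Sum>I\<in>subintervals m (J n m). haar (\<tau> I) x) else 0)"
    for \<tau> x m
  proof (cases "m \<in> {1..n}")
    case True
    have "haar_sum \<tau> a x m = (\<Sum>I\<in>S. a I m * haar (\<tau> I) x)"
      unfolding haar_sum_def S_def ..
    also have "\<dots> = (\<Sum>I\<in>subintervals m (J n m). c * haar (\<tau> I) x)"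
      using True fin unfolding S by (intro sum.mono_neutral_cong_right) (auto simp: a_def)
    finally show ?thesis using True by (simp add: sum_distrib_left)
  next
    case False
    then have "a I m = 0" for I unfolding a_def by auto
    then show ?thesis unfolding if_not_P[OF False] by (simp add: haar_sum_def)
  qed
  have before: "lp_norm p (haar_sum (\<lambda>I. I) a x) = c * indicator (\<Union>m\<in>{1..n}. J n m) x" for x
  proof -
    have "lp_norm p (haar_sum (\<lambda>I. I) a x) = (\<Sum>m\<in>{1..n}. (c * indicator (J n m) x) powr p) powr (1 / p)"
    proof (rule lp_norm_finite_support)
      show "\<bar>haar_sum (\<lambda>I. I) a x m\<bar> = (if m \<in> {1..n} then c * indicator (J n m) x else 0)" for m
        using c abs_sum_haar_subintervals[of "J n m" x m] Jd[of m] unfolding comp by (auto simp: abs_mult)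
    qed (use assms in auto)
    also have "\<dots> = c * indicator (\<Union>m\<in>{1..n}. J n m) x"
    proof (cases "\<exists>m\<in>{1..n}. x \<in> J n m")
      case True
      then obtain m where m: "m \<in> {1..n}" "x \<in> J n m" by blast
      have "(c * indicator (J n m') x) powr p = (if m' = m then c powr p else 0)" if "m' \<in> {1..n}" for m'
      proof (cases "m' = m")
        case True
        then show ?thesis using m by simp
      next
        case False
        then have "x \<notin> J n m'"
          using block_unique[OF assms(1,4) _ assms(4), of m' m x] that m by auto
        then show ?thesis using False by simp
      qed
      then have "(\<Sum>m'\<in>{1..n}. (c * indicator (J n m') x) powr p) = (\<Sum>m'\<in>{1..n}. if m' = m then c powr p else 0)"
        by (intro sum.cong refl)
      also have "\<dots> = c powr p" using m by simp
      finally show ?thesis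
        using m c assms by (auto simp: powr_powr indicator_def)
    next
      case False
      then show ?thesis by auto
    qed
    finally show ?thesis .
  qed
  have after: "lp_norm p (haar_sum (tau0 J) a x) = real n powr (1 / p) * c * indicator (J n 0) x" for x
  proof -
    have "lp_norm p (haar_sum (tau0 J) a x) = (\<Sum>m\<in>{1..n}. (c * indicator (J n 0) x) powr p) powr (1 / p)"
    proof (rule lp_norm_finite_support)
      fix m
      show "\<bar>haar_sum (tau0 J) a x m\<bar> = (if m \<in> {1..n} then c * indicator (J n 0) x else 0)"
      proof (cases "m \<in> {1..n}")
        case True
        have Jlm: "len (J n m) = len (J n 0)" using Jl True by auto
        have inj: "inj_on (shift (J n m) (J n 0)) (subintervals m (J n m))"
          by (rule inj_on_inverseI[of _ "shift (J n 0) (J n m)"]) (rule shift_shift)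
        have img: "shift (J n m) (J n 0) ` subintervals m (J n m) = subintervals m (J n 0)"
        proof (intro equalityI subsetI)
          fix I assume I: "I \<in> subintervals m (J n 0)"
          then have "shift (J n 0) (J n m) I \<in> subintervals m (J n m)"
            using Jd Jlm True by (intro shift_subinterval) auto
          then show "I \<in> shift (J n m) (J n 0) ` subintervals m (J n m)"
            using shift_shift by (metis imageI)
        qed (use Jd Jlm True in \<open>auto intro: shift_subinterval\<close>)
        have "(\<Sum>I\<in>subintervals m (J n m). haar (tau0 J I) x)
            = (\<Sum>I\<in>subintervals m (J n m). haar (shift (J n m) (J n 0) I) x)"
          using tau0_back[OF assms(1) True] by (intro sum.cong) auto
        also have "\<dots> = (\<Sum>I\<in>subintervals m (J n 0). haar I x)"
          using sum.reindex[OF inj, of "\<lambda>I. haar I x"] unfolding img by simp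
        finally show ?thesis
          using True c abs_sum_haar_subintervals[OF Jd[of 0], of x m] unfolding comp
          by (auto simp: abs_mult)
      next
        case False
        then show ?thesis unfolding comp if_not_P[OF False] by simp
      qed
    qed (use assms in auto)
    also have "\<dots> = real n powr (1 / p) * c * indicator (J n 0) x"
      using assms c by (auto simp: powr_mult powr_powr indicator_def)
    finally show ?thesis .
  qed
  have meas: "J n m \<in> sets lborel" "J n m \<subseteq> {0..<1}" "emeasure lborel (J n m) < \<infinity>" if "m \<le> n" for m
  proof -
    show "J n m \<in> sets lborel"
      using Jd[OF that] by (auto simp: cell_def elim!: dyadic_cell)
    show "J n m \<subseteq> {0..<1}"
      by (rule dyadic_subset_unit[OF Jd[OF that]])
    then show "emeasure lborel (J n m) < \<infinity>"
      by (rule emeasure_unit_subset)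
  qed
  have lenU: "len (\<Union>m\<in>{1..n}. J n m) = real n * l"
  proof -
    have "disjoint_family_on (J n) {1..n}"
      using assms(1,4) unfolding block_system_def disjoint_family_on_def by auto
    then have "len (\<Union>m\<in>{1..n}. J n m) = (\<Sum>m\<in>{1..n}. len (J n m))"
      using meas by (intro measure_finite_Union) (auto simp: less_top)
    then show ?thesis using Jl by simp
  qed
  have U: "(\<Union>m\<in>{1..n}. J n m) \<subseteq> {0..<1}" "(\<Union>m\<in>{1..n}. J n m) \<in> sets lborel"
    using meas(1,2) by (intro UN_least sets.finite_UN; simp)+
  have "bochner_norm q (lp_norm p) (haar_sum (\<lambda>I. I) a) = c * (real n * l) powr (1 / q)"
    unfolding lenU[symmetric]
    using bochner_norm_indicator[where N = "lp_norm p" and f = "haar_sum (\<lambda>I. I) a", OF assms(3) _ U before] c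
    by simp
  also have "\<dots> = 1"
    using assms l unfolding c_def by (simp add: powr_add[symmetric])
  finally have one: "bochner_norm q (lp_norm p) (haar_sum (\<lambda>I. I) a) \<le> 1" by simp
  have "bochner_norm q (lp_norm p) (haar_sum (tau0 J) a) = real n powr (1 / p) * c * l powr (1 / q)"
    unfolding l_def using assms c meas[of 0]
    by (intro bochner_norm_indicator[where N = "lp_norm p" and f = "haar_sum (tau0 J) a", OF _ _ _ _ after]) auto
  also have "\<dots> = real n powr (1 / p - 1 / q)"
  proof -
    have "c * l powr (1 / q) = real n powr (- 1 / q) * (l powr (- 1 / q) * l powr (1 / q))"
      using l unfolding c_def by (simp add: powr_mult)
    also have "\<dots> = real n powr (- 1 / q)"
      using l by (simp flip: powr_add)
    finally show ?thesis
      by (simp add: mult.assoc flip: powr_add)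
  qed
  finally have val: "bochner_norm q (lp_norm p) (haar_sum (tau0 J) a) = real n powr (1 / p - 1 / q)" .
  show ?thesis
    unfolding rearr_opnorm_def using a one by (intro SUP_upper2[of a]) (auto simp: val)
qed

lemma rearr_opnorm_infinite:
  assumes "block_system J" "0 < p" "p < q"
  shows "rearr_opnorm q (lp p) (lp_norm p) (tau0 J) = \<infinity>"
proof (rule ccontr)
  assume "rearr_opnorm q (lp p) (lp_norm p) (tau0 J) \<noteq> \<infinity>"
  then obtain r where r: "0 \<le> r" "rearr_opnorm q (lp p) (lp_norm p) (tau0 J) = ennreal r"
    by (metis ennreal_cases infinity_ennreal_def)
  define s where "s = 1 / p - 1 / q"
  have s: "0 < s" using assms unfolding s_def by (simp add: field_simps)
  \<comment> \<open>Large enough that \<open>n\<^sup>s \<ge> r + 1\<close>.\<close>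
  define n where "n = nat \<lceil>(r + 1) powr (1 / s)\<rceil>"
  have n: "(r + 1) powr (1 / s) \<le> real n" unfolding n_def by (rule real_nat_ceiling_ge)
  then have "0 < real n" using r(1) by (smt (verit) powr_gt_zero)
  then have n1: "1 \<le> n" by simp
  have "r + 1 = ((r + 1) powr (1 / s)) powr s" using s r(1) by (simp add: powr_powr)
  also have "\<dots> \<le> real n powr s" using n s by (intro powr_mono2) auto
  finally have "r + 1 \<le> real n powr s" .
  moreover have "ennreal (real n powr s) \<le> ennreal r"
    using rearr_opnorm_ge[OF assms(1,2) _ n1, of q] assms unfolding r(2) s_def by simp
  then have "real n powr s \<le> r" using r(1) by (simp add: ennreal_le_iff)
  ultimately show False by simp
qed

theorem corollary3p3:
  fixes J :: "nat \<Rightarrow> nat \<Rightarrow> real set" and p :: real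
  assumes "block_system J" and "1 < p" and "p < 2"
  shows "bij_betw (tau0 J) dyadic dyadic \<and>
         (\<forall>I\<in>dyadic. len (tau0 J I) = len I) \<and>
         rearr_opnorm p (lp p) (lp_norm p) (tau0 J) < \<infinity> \<and>
         (\<forall>q. p < q \<and> q \<le> 2 \<longrightarrow> rearr_opnorm q (lp p) (lp_norm p) (tau0 J) = \<infinity>)"
  using assms tau0_bij tau0_dyadic_len rearr_opnorm_finite[of J p] rearr_opnorm_infinite[of J p]
  by auto

end
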